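(* Let $\Omega$ be a lattice in $\mathbb{C}$, let $\wp$ and $\zeta$ be the Weierstrass elliptic function and the Weierstrass zeta function associated with $\Omega$, and let $\zeta_R$ be the Riemann zeta function (meromorphically continued to $\mathbb{C}$). Then the four functions $z,\ \wp(z),\ \zeta(z),\ \zeta_R(z)$ are algebraically independent over $\mathbb{C}$.
   Context: For a lattice $\Omega$ in $\mathbb{C}$, $\sigma(z)=z\prod_{\omega\in\Omega\smallsetminus\{0\}}\left(1-\frac z\omega\right)\exp\left(\frac z\omega+\frac{z^2}{2\omega^2}\right)$ is the Weierstrass sigma function, $\zeta=\sigma'/\sigma$ is the Weierstrass zeta function, and $\wp=-\zeta'$. *)

theory Defs
  imports "HOL-Complex_Analysis.Complex_Analysis" "HOL-Library.Poly_Mapping"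
begin

definition is_lattice :: "complex set \<Rightarrow> bool" where
  "is_lattice \<Omega> \<longleftrightarrow>
     (\<exists>\<omega>\<^sub>1 \<omega>\<^sub>2. \<omega>\<^sub>1 \<noteq> \<omega>\<^sub>2 \<and> independent {\<omega>\<^sub>1, \<omega>\<^sub>2} \<and>
        \<Omega> = {of_int m * \<omega>\<^sub>1 + of_int n * \<omega>\<^sub>2 | m n. True})"

text \<open>
  The product over \<open>\<Omega> - {0}\<close> is the limit of the products over the finite subsets of
  \<open>\<Omega> - {0}\<close>, so that no enumeration of \<open>\<Omega>\<close> is involved (as for \<^const>\<open>infsum\<close>).
\<close>

definition weierstrass_sigma :: "complex set \<Rightarrow> complex \<Rightarrow> complex" where
  "weierstrass_sigma \<Omega> z =
     z * Lim (finite_subsets_at_top (\<Omega> - {0}))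
           (\<lambda>F. \<Prod>\<omega>\<in>F. (1 - z / \<omega>) * exp (z / \<omega> + z\<^sup>2 / (2 * \<omega>\<^sup>2)))"

text \<open>
  The values of the next two functions at the points of \<open>\<Omega>\<close>, which are their poles, are
  meaningless.
\<close>

definition weierstrass_zeta :: "complex set \<Rightarrow> complex \<Rightarrow> complex" where
  "weierstrass_zeta \<Omega> z = deriv (weierstrass_sigma \<Omega>) z / weierstrass_sigma \<Omega> z"

definition weierstrass_p :: "complex set \<Rightarrow> complex \<Rightarrow> complex" where
  "weierstrass_p \<Omega> z = - deriv (weierstrass_zeta \<Omega>) z"

text \<open>
  The Riemann zeta function is the meromorphic continuation to the whole plane of its Dirichlet
  series. By the identity theorem there is only one; \<^const>\<open>nicely_meromorphic_on\<close> also fixes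
  the value 0 at the pole and excludes removable singularities.
\<close>

definition riemann_zeta :: "complex \<Rightarrow> complex" where
  "riemann_zeta =
     (SOME f. f nicely_meromorphic_on UNIV \<and>
        (\<forall>s. Re s > 1 \<longrightarrow> f s = suminf (\<lambda>n. 1 / of_nat (Suc n) powr s)))"

text \<open>
  A polynomial over \<open>\<complex>\<close> in variables \<open>X\<^sub>0, X\<^sub>1, \<dots>\<close> is a finitely supported map from
  monomials to coefficients, where a monomial is a finitely supported map from variable indices
  to exponents.
\<close>

definition mpoly_eval :: "((nat \<Rightarrow>\<^sub>0 nat) \<Rightarrow>\<^sub>0 complex) \<Rightarrow> (nat \<Rightarrow> complex) \<Rightarrow> complex" where
  "mpoly_eval P x =
     (\<Sum>m\<in>Poly_Mapping.keys P. Poly_Mapping.lookup P m *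
        (\<Prod>i\<in>Poly_Mapping.keys m. x i ^ Poly_Mapping.lookup m i))"

text \<open>
  Algebraic independence over \<open>\<complex>\<close> of meromorphic functions on the plane. Two meromorphic
  functions are identified if they agree outside a set without accumulation points in the plane,
  that is, eventually with respect to the filter \<^term>\<open>cosparse UNIV\<close>; so a relation between the
  functions is tested there, and their values at poles are irrelevant.
\<close>

definition algebraically_independent :: "(complex \<Rightarrow> complex) list \<Rightarrow> bool" where
  "algebraically_independent fs \<longleftrightarrow>
     (\<forall>P. (\<forall>m\<in>Poly_Mapping.keys P. Poly_Mapping.keys m \<subseteq> {..<length fs}) \<longrightarrow>
          (\<forall>\<^sub>F z in cosparse UNIV. mpoly_eval P (\<lambda>i. (fs ! i) z) = 0) \<longrightarrow> P = 0)"

end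

(*
  Write a relation between the four functions as a polynomial T in z, p(z), zeta(z) and
  W = zeta_R(z), and pull out the largest power of W - 1: T = (W - 1)^n T' with T'(W = 1) nonzero.
  Fix a generic z0 and evaluate at z0 + k w1 + n w2, where (w1, w2) is a basis of the lattice with
  Re w1 > 0.  There p has the constant value p(z0), the functions z and zeta are affine in (k, n)
  with linear parts (w1, w2) and (eta1, eta2), and W - 1 is nonzero and exponentially small as
  k tends to infinity, because zeta_R(s) - 1 is asymptotic to 2^(-s).  Hence T'(W = 1), a polynomial
  in (k, n), tends to 0 as k tends to infinity, so it vanishes identically.  Since
  w1 eta2 - w2 eta1 is nonzero, T'(W = 1) vanishes as a polynomial in z and zeta for the value p(z0),
  and as p takes infinitely many values, it is zero: a contradiction.

  If w1 eta2 = w2 eta1, then for some c the entire function sigma(z) exp(-c z^2 / 2) is multiplied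
  by constants under translation by the lattice, and for a suitable a the modulus of
  sigma(z) exp(-c z^2 / 2 + a z) is periodic.  By Liouville's theorem this function is constant,
  although its zeros are exactly the lattice points.
*)
theory Submission
  imports Defs "HOL-Real_Asymp.Real_Asymp"
begin

section \<open>Polynomials in four variables\<close>

text \<open>The decay of zeta_R - 1 is available only in a right half-plane, which is why a basis
  with Re w1 > 0 is needed and why only k is sent to infinity while n stays fixed. Two extension
  steps follow: for each natural n the polynomial vanishes for all complex k, and then for all
  complex n. Powers of W - 1 must be removed before the limit: along the sample points W tends to 1,
  so a relation divisible by W - 1 would only yield 0 = 0 in the limit. What remains is T'(W = 1)
  plus W - 1 times a cofactor of polynomial growth, and exponential decay beats that growth. The
  relation is assumed only off a sparse set. Such a set is countable, and so is the union of its
  lattice translates; a generic z0 is one outside that union and outside the lattice. Two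
  definitions resist direct use. \<open>riemann_zeta\<close> is a SOME-choice, so nothing is known
  of it until a meromorphic continuation has been constructed; Euler's transformation of the
  alternating series supplies one. The product of sigma is an unordered limit; it is computed by
  splitting off finitely many factors and summing the logarithms of the others.\<close>

definition eval3 :: "complex poly poly poly \<Rightarrow> complex \<Rightarrow> complex \<Rightarrow> complex \<Rightarrow> complex" where
  "eval3 S p x y = poly (poly (poly S [:[:y:]:]) [:x:]) p"

text \<open>W is the outermost variable, so that \<open>order\<close> and
  \<open>synthetic_div\<close> at W = 1 apply directly. The variable for p is the innermost one, so
  that for fixed x and y there remains an ordinary complex polynomial in p.\<close>

definition eval4 ::
  "complex poly poly poly poly \<Rightarrow> complex \<Rightarrow> complex \<Rightarrow> complex \<Rightarrow> complex \<Rightarrow> complex" where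
  "eval4 T p x y w = eval3 (poly T [:[:[:w:]:]:]) p x y"

lemma eval3_add: "eval3 (S + S') p x y = eval3 S p x y + eval3 S' p x y"
  and eval3_smult: "eval3 (smult [:[:c:]:] S) p x y = c * eval3 S p x y"
  by (simp_all add: eval3_def)

lemma eval4_add: "eval4 (T + T') p x y w = eval4 T p x y w + eval4 T' p x y w"
  and eval4_mult: "eval4 (T * T') p x y w = eval4 T p x y w * eval4 T' p x y w"
  and eval4_power: "eval4 (T ^ n) p x y w = eval4 T p x y w ^ n"
  and eval4_linear: "eval4 [:-1, 1:] p x y w = w - 1"
  and eval4_const: "eval4 [:S:] p x y w = eval3 S p x y"
  by (simp_all add: eval4_def eval3_def)

lemma eval4_divide_linear:
  obtains V where "\<And>p x y w. eval4 T p x y w = (w - 1) * eval4 V p x y w + eval3 (poly T 1) p x y"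
proof
  fix p x y w
  have "T = [:-1, 1:] * synthetic_div T 1 + [:poly T 1:]"
    by (metis synthetic_div_correct')
  then have "eval4 T p x y w = eval4 ([:-1, 1:] * synthetic_div T 1 + [:poly T 1:]) p x y w"
    by simp
  then show "eval4 T p x y w = (w - 1) * eval4 (synthetic_div T 1) p x y w + eval3 (poly T 1) p x y"
    by (simp only: eval4_add eval4_mult eval4_linear eval4_const)
qed

lemma infinite_const_poly: "infinite A \<Longrightarrow> infinite ((\<lambda>x. [:x:]) ` A)"
  by (subst finite_image_iff) (auto simp: inj_on_def)

text \<open>At every level the coefficient ring is an integral domain, so a nonzero polynomial has
  finitely many roots, whereas there are infinitely many constants. Hence y, x and p can be chosen
  one after the other.\<close>

lemma eval3_nonzero_ex:
  assumes "S \<noteq> 0"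
  obtains p x y where "eval3 S p x y \<noteq> 0"
proof -
  have inf: "infinite (range (\<lambda>x::complex. [:x:]))"
    by (rule infinite_const_poly[OF infinite_UNIV_char_0])
  then have "infinite ((\<lambda>x. [:x:]) ` range (\<lambda>x::complex. [:x:]))"
    by (rule infinite_const_poly)
  then have "\<not> (\<lambda>x. [:x:]) ` range (\<lambda>x::complex. [:x:]) \<subseteq> {z. poly S z = 0}"
    using poly_roots_finite[OF assms] finite_subset by metis
  then obtain y where y: "poly S [:[:y:]:] \<noteq> 0" by auto
  have "\<not> range (\<lambda>x::complex. [:x:]) \<subseteq> {z. poly (poly S [:[:y:]:]) z = 0}"
    using poly_roots_finite[OF y] finite_subset inf by metis
  then obtain x where x: "poly (poly S [:[:y:]:]) [:x:] \<noteq> 0" by auto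
  then obtain p where "poly (poly (poly S [:[:y:]:]) [:x:]) p \<noteq> 0"
    using poly_all_0_iff_0 by blast
  then show ?thesis using that by (simp add: eval3_def)
qed

lemma eval3_eq_0I:
  assumes "infinite A" "\<And>p x y. p \<in> A \<Longrightarrow> eval3 S p x y = 0"
  shows "S = 0"
proof (rule ccontr)
  assume "S \<noteq> 0"
  then obtain p x y where *: "eval3 S p x y \<noteq> 0" by (rule eval3_nonzero_ex)
  then have "finite {p. eval3 S p x y = 0}"
    unfolding eval3_def by (intro poly_roots_finite) auto
  moreover have "A \<subseteq> {p. eval3 S p x y = 0}" using assms(2) by auto
  ultimately show False using assms(1) finite_subset by blast
qed

text \<open>Two classes need closure under evaluation of nested polynomials: polynomial functions of
  one complex parameter, and sequences of polynomial growth. The locale lets the inductions be done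
  once.\<close>

locale function_algebra =
  fixes \<Phi> :: "('i \<Rightarrow> complex) \<Rightarrow> bool"
  assumes const: "\<Phi> (\<lambda>i. c)"
    and add: "\<Phi> f \<Longrightarrow> \<Phi> g \<Longrightarrow> \<Phi> (\<lambda>i. f i + g i)"
    and mult: "\<Phi> f \<Longrightarrow> \<Phi> g \<Longrightarrow> \<Phi> (\<lambda>i. f i * g i)"
begin

lemma poly1: "\<Phi> p \<Longrightarrow> \<Phi> (\<lambda>i. poly R (p i))"
  by (induction R) (auto intro: const add mult)

lemma poly2: "\<Phi> p \<Longrightarrow> \<Phi> x \<Longrightarrow> \<Phi> (\<lambda>i. poly (poly R [:x i:]) (p i))"
  by (induction R) (auto intro!: const add mult poly1)

lemma eval3: "\<Phi> p \<Longrightarrow> \<Phi> x \<Longrightarrow> \<Phi> y \<Longrightarrow> \<Phi> (\<lambda>i. eval3 S (p i) (x i) (y i))"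
  unfolding eval3_def by (induction S) (auto intro!: const add mult poly2)

lemma eval4: "\<Phi> p \<Longrightarrow> \<Phi> x \<Longrightarrow> \<Phi> y \<Longrightarrow> \<Phi> w \<Longrightarrow> \<Phi> (\<lambda>i. eval4 T (p i) (x i) (y i) (w i))"
proof (induction T)
  case 0
  show ?case using const[of 0] by (simp add: eval4_def eval3_def)
next
  case (pCons S T)
  have "eval4 (pCons S T) p x y w = eval3 S p x y + w * eval4 T p x y w" for p x y w
    by (simp add: eval4_def eval3_add eval3_smult)
  then show ?case using pCons by (auto intro!: const add mult eval3)
qed

end

definition polynomial_fun :: "(complex \<Rightarrow> complex) \<Rightarrow> bool" where
  "polynomial_fun f \<longleftrightarrow> (\<exists>q. \<forall>t. f t = poly q t)"

interpretation polynomial_fun: function_algebra polynomial_fun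
proof
  show "polynomial_fun (\<lambda>i. c)" for c
    unfolding polynomial_fun_def by (intro exI[of _ "[:c:]"]) simp
  show "polynomial_fun (\<lambda>i. f i + g i)" if "polynomial_fun f" "polynomial_fun g" for f g
    using that unfolding polynomial_fun_def by (metis poly_add)
  show "polynomial_fun (\<lambda>i. f i * g i)" if "polynomial_fun f" "polynomial_fun g" for f g
    using that unfolding polynomial_fun_def by (metis poly_mult)
qed

lemma polynomial_fun_id: "polynomial_fun (\<lambda>t. t)"
  unfolding polynomial_fun_def by (intro exI[of _ "[:0, 1:]"]) simp

text \<open>The base \<open>Suc k\<close> is at least 1, so the bound is monotone in the exponent
  and also makes sense at k = 0.\<close>

definition poly_bounded :: "(nat \<Rightarrow> complex) \<Rightarrow> bool" where
  "poly_bounded f \<longleftrightarrow> (\<exists>C D. \<forall>k. norm (f k) \<le> C * real (Suc k) ^ D)"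

interpretation poly_bounded: function_algebra poly_bounded
proof
  show "poly_bounded (\<lambda>i. c)" for c
    unfolding poly_bounded_def by (intro exI[of _ "norm c"] exI[of _ 0]) simp
next
  fix f g assume "poly_bounded f" "poly_bounded g"
  then obtain C D C' D' where f: "\<And>k. norm (f k) \<le> C * real (Suc k) ^ D"
    and g: "\<And>k. norm (g k) \<le> C' * real (Suc k) ^ D'"
    unfolding poly_bounded_def by metis
  \<comment> \<open>At k = 0 the power is 1, so the bounds read norm (f 0) \<le> C and norm (g 0)
    \<le> C'.\<close>
  have nonneg: "C \<ge> 0" "C' \<ge> 0" using order_trans[OF norm_ge_zero f[of 0]]
      order_trans[OF norm_ge_zero g[of 0]] by simp_all
  show "poly_bounded (\<lambda>i. f i * g i)"
    unfolding poly_bounded_def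
  proof (intro exI[of _ "C * C'"] exI[of _ "D + D'"] allI)
    fix k
    have "norm (f k * g k) \<le> (C * real (Suc k) ^ D) * (C' * real (Suc k) ^ D')"
      unfolding norm_mult using f g nonneg by (intro mult_mono) auto
    then show "norm (f k * g k) \<le> C * C' * real (Suc k) ^ (D + D')"
      by (simp add: power_add mult_ac)
  qed
  show "poly_bounded (\<lambda>i. f i + g i)"
    unfolding poly_bounded_def
  proof (intro exI[of _ "C + C'"] exI[of _ "D + D'"] allI)
    fix k
    have "norm (f k + g k) \<le> C * real (Suc k) ^ D + C' * real (Suc k) ^ D'"
      using f g by (intro norm_triangle_mono)
    also have "\<dots> \<le> C * real (Suc k) ^ (D + D') + C' * real (Suc k) ^ (D + D')"
      using nonneg by (intro add_mono mult_left_mono power_increasing) auto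
    finally show "norm (f k + g k) \<le> (C + C') * real (Suc k) ^ (D + D')"
      by (simp add: algebra_simps)
  qed
qed

lemma poly_bounded_bounded: "(\<And>k. norm (f k) \<le> B) \<Longrightarrow> poly_bounded f"
  unfolding poly_bounded_def by (intro exI[of _ B] exI[of _ 0]) simp

lemma poly_bounded_of_nat: "poly_bounded of_nat"
  unfolding poly_bounded_def by (intro exI[of _ 1]) auto

lemma poly_bounded_times_exp_decay:
  assumes "poly_bounded f" and u: "\<forall>\<^sub>F k in sequentially. norm (u k) \<le> C * r ^ k"
    and r: "0 < r" "r < 1"
  shows "(\<lambda>k. u k * f k) \<longlonglongrightarrow> 0"
proof -
  obtain B D where f: "\<And>k. norm (f k) \<le> B * real (Suc k) ^ D"
    using assms(1) unfolding poly_bounded_def by metis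
  have "(\<lambda>k. r ^ k * real (Suc k) ^ D) \<longlonglongrightarrow> 0"
    using r by real_asymp
  then have lim: "(\<lambda>k. (C * B) * (r ^ k * real (Suc k) ^ D)) \<longlonglongrightarrow> 0"
    by (rule tendsto_mult_right_zero)
  have bound: "\<forall>\<^sub>F k in sequentially. norm (u k * f k) \<le> (C * B) * (r ^ k * real (Suc k) ^ D)"
    using u
  proof eventually_elim
    case (elim k)
    have "norm (u k * f k) \<le> (C * r ^ k) * (B * real (Suc k) ^ D)"
      unfolding norm_mult
      by (rule mult_mono[OF elim f order_trans[OF norm_ge_zero elim] norm_ge_zero])
    then show ?case by (simp add: mult_ac)
  qed
  show ?thesis
    by (rule Lim_null_comparison[OF bound lim])
qed

text \<open>A nonconstant polynomial tends to infinity along the naturals. This turns decay along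
  lattice points into an identity.\<close>

lemma poly_eq_0_if_tendsto_0:
  fixes q :: "complex poly"
  assumes "(\<lambda>k. poly q (of_nat k)) \<longlonglongrightarrow> 0"
  shows "q = 0"
proof -
  have "degree q = 0"
  proof (rule ccontr)
    assume "degree q \<noteq> 0"
    then have "filterlim (\<lambda>k. poly q (of_nat k)) at_infinity sequentially"
      by (intro filterlim_compose[OF filterlim_poly_at_infinity tendsto_of_nat]) auto
    with assms show False
      using not_tendsto_and_filterlim_at_infinity[OF sequentially_bot] by blast
  qed
  then obtain a where "q = [:a:]" by (rule degree_eq_zeroE)
  then show ?thesis using assms by (simp add: LIMSEQ_const_iff)
qed

text \<open>The nesting order is that of \<open>eval4\<close>, not that of the list of functions:
  exponent 1 (p) is innermost, followed by 0 (z), 2 (Weierstrass zeta) and 3 (Riemann zeta).\<close>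

definition nested_poly :: "((nat \<Rightarrow>\<^sub>0 nat) \<Rightarrow>\<^sub>0 complex) \<Rightarrow> complex poly poly poly poly" where
  "nested_poly P = (\<Sum>m\<in>Poly_Mapping.keys P.
     monom (monom (monom (monom (Poly_Mapping.lookup P m) (Poly_Mapping.lookup m 1))
       (Poly_Mapping.lookup m 0)) (Poly_Mapping.lookup m 2)) (Poly_Mapping.lookup m 3))"

lemma eval4_nested_poly:
  assumes "\<forall>m\<in>Poly_Mapping.keys P. Poly_Mapping.keys m \<subseteq> {..<4}"
  shows "eval4 (nested_poly P) p x y w = mpoly_eval P (\<lambda>i. [x, p, y, w] ! i)"
proof -
  have "(\<Prod>i\<in>Poly_Mapping.keys m. [x, p, y, w] ! i ^ Poly_Mapping.lookup m i) =
      x ^ Poly_Mapping.lookup m 0 * p ^ Poly_Mapping.lookup m 1 *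
      y ^ Poly_Mapping.lookup m 2 * w ^ Poly_Mapping.lookup m 3"
    if "m \<in> Poly_Mapping.keys P" for m
  proof -
    have "(\<Prod>i\<in>Poly_Mapping.keys m. [x, p, y, w] ! i ^ Poly_Mapping.lookup m i) =
      (\<Prod>i<4. [x, p, y, w] ! i ^ Poly_Mapping.lookup m i)"
      using assms that by (intro prod.mono_neutral_left) (auto simp: in_keys_iff)
    also have "\<dots> = x ^ Poly_Mapping.lookup m 0 * p ^ Poly_Mapping.lookup m 1 *
      y ^ Poly_Mapping.lookup m 2 * w ^ Poly_Mapping.lookup m 3"
      by (simp add: eval_nat_numeral)
    finally show ?thesis .
  qed
  then show ?thesis
    by (simp add: nested_poly_def mpoly_eval_def eval4_def eval3_def poly_sum poly_monom mult_ac
        flip: power_mult_distrib poly_const_pow)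
qed

text \<open>A monomial in the variables 0 to 3 is determined by its four exponents, so each
  coefficient of P reappears as exactly one iterated coefficient of the nested polynomial.\<close>

lemma nested_poly_eq_0D:
  assumes "\<forall>m\<in>Poly_Mapping.keys P. Poly_Mapping.keys m \<subseteq> {..<4}" "nested_poly P = 0"
  shows "P = 0"
proof (rule poly_mapping_eqI, rule ccontr)
  fix m assume "Poly_Mapping.lookup P m \<noteq> Poly_Mapping.lookup 0 m"
  then have m: "m \<in> Poly_Mapping.keys P" by (simp add: in_keys_iff)
  have eq: "m' = m" if m': "m' \<in> Poly_Mapping.keys P"
    and same: "\<And>i. i \<in> {0,1,2,3} \<Longrightarrow> Poly_Mapping.lookup m' i = Poly_Mapping.lookup m i" for m'
  proof (rule poly_mapping_eqI)
    fix i
    consider "i \<in> {0,1,2,3}" | "i \<notin> Poly_Mapping.keys m" "i \<notin> Poly_Mapping.keys m'"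
      using bspec[OF assms(1) m] bspec[OF assms(1) m'] by (cases "i < 4") force+
    then show "Poly_Mapping.lookup m' i = Poly_Mapping.lookup m i"
      by cases (use same in \<open>auto simp: in_keys_iff\<close>)
  qed
  have "0 = coeff (coeff (coeff (coeff (nested_poly P) (Poly_Mapping.lookup m 3))
     (Poly_Mapping.lookup m 2)) (Poly_Mapping.lookup m 0)) (Poly_Mapping.lookup m 1)"
    using assms(2) by simp
  also have "\<dots> = (\<Sum>m'\<in>Poly_Mapping.keys P. if m' = m then Poly_Mapping.lookup P m' else 0)"
    unfolding nested_poly_def coeff_sum
  proof (intro sum.cong refl)
    fix m' assume "m' \<in> Poly_Mapping.keys P"
    then show "coeff (coeff (coeff (coeff (monom (monom (monom (monom (Poly_Mapping.lookup P m')
      (Poly_Mapping.lookup m' 1)) (Poly_Mapping.lookup m' 0)) (Poly_Mapping.lookup m' 2))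
      (Poly_Mapping.lookup m' 3)) (Poly_Mapping.lookup m 3)) (Poly_Mapping.lookup m 2))
      (Poly_Mapping.lookup m 0)) (Poly_Mapping.lookup m 1) =
      (if m' = m then Poly_Mapping.lookup P m' else 0)"
      using eq[of m'] by (auto simp: coeff_monom)
  qed
  also have "\<dots> = Poly_Mapping.lookup P m" using m by simp
  finally show False using m by (simp add: in_keys_iff)
qed

section \<open>The Riemann zeta function\<close>

text \<open>Up to the sign (-1)^K this is the K-th forward difference of x^(-s) with step 1. Each
  difference gains one power of x in decay.\<close>

primrec powr_fdiff :: "nat \<Rightarrow> complex \<Rightarrow> complex \<Rightarrow> complex" where
  "powr_fdiff 0 s x = x powr (-s)"
| "powr_fdiff (Suc K) s x = powr_fdiff K s x - powr_fdiff K s (x + 1)"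

text \<open>Differencing commutes with d/dx, and d/dx sends x^(-s) to -s x^(-(s+1)).\<close>

lemma has_field_derivative_powr_fdiff:
  "Re x > 0 \<Longrightarrow> (powr_fdiff K s has_field_derivative - s * powr_fdiff K (s + 1) x) (at x)"
proof (induction K arbitrary: x)
  case 0
  then have "x \<notin> \<real>\<^sub>\<le>\<^sub>0" by (auto simp: complex_nonpos_Reals_iff)
  from has_field_derivative_powr[OF this, of "-s"] show ?case
    by (simp add: minus_diff_commute[of 1 s])
next
  case (Suc K)
  have "((\<lambda>x. powr_fdiff K s (x + 1)) has_field_derivative - s * powr_fdiff K (s + 1) (x + 1)) (at x)"
    using Suc.IH[of "x + 1"] Suc.prems by (subst DERIV_shift[symmetric]) (auto simp: add.commute)
  from DERIV_diff[OF Suc.IH[OF Suc.prems] this] show ?case by (simp add: algebra_simps)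
qed

lemma holomorphic_powr_fdiff: "Re x > 0 \<Longrightarrow> (\<lambda>s. powr_fdiff K s x) holomorphic_on A"
  by (induction K arbitrary: x) (auto intro!: holomorphic_intros)

text \<open>Each difference is bounded by the supremum of the derivative on [r, r+1]. The derivative
  brings out a factor s and shifts s to s + 1, so the induction collects s, s + 1, ..., s + K - 1.
  The condition on Re s makes the power of y decreasing, so its largest value is at the left end
  r.\<close>

lemma norm_powr_fdiff_le:
  assumes "r > 0" "Re s + real K \<ge> 0"
  shows "norm (powr_fdiff K s (of_real r)) \<le> (\<Prod>j<K. norm (s + of_nat j)) * r powr (- (Re s + real K))"
  using assms
proof (induction K arbitrary: s r)
  case 0
  then show ?case by (simp add: norm_powr_real_powr)
next
  case (Suc K)
  define C where "C = (\<Prod>j<Suc K. norm (s + of_nat j))"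
  have C: "C = norm s * (\<Prod>j<K. norm (s + 1 + of_nat j))"
    unfolding C_def prod.lessThan_Suc_shift by (simp add: add_ac)
  define S where "S = complex_of_real ` {r..r+1}"
  have "norm (powr_fdiff K s (of_real r) - powr_fdiff K s (of_real (r + 1)))
      \<le> (C * r powr (- (Re s + real (Suc K)))) * norm (complex_of_real r - of_real (r + 1))"
  proof (rule field_differentiable_bound[of S])
    show "convex S"
      unfolding S_def by (intro convex_linear_image) (auto intro: linearI simp: scaleR_conv_of_real)
    fix z assume "z \<in> S"
    then obtain y where y: "z = of_real y" "r \<le> y" "y > 0" using Suc.prems by (auto simp: S_def)
    show "(powr_fdiff K s has_field_derivative - s * powr_fdiff K (s + 1) z) (at z within S)"
      using has_field_derivative_powr_fdiff[of z K s] y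
      by (auto intro: has_field_derivative_at_within)
    have "norm (- s * powr_fdiff K (s + 1) z) \<le> norm s * ((\<Prod>j<K. norm (s + 1 + of_nat j)) * y powr (- (Re (s + 1) + real K)))"
      unfolding norm_mult norm_minus_cancel y(1)
      using Suc.prems y by (intro mult_left_mono Suc.IH) auto
    also have "\<dots> = C * y powr (- (Re s + real (Suc K)))"
      unfolding C by (simp add: algebra_simps)
    also have "\<dots> \<le> C * r powr (- (Re s + real (Suc K)))"
      using y Suc.prems by (intro mult_left_mono powr_mono2') (auto simp: C_def prod_nonneg)
    finally show "norm (- s * powr_fdiff K (s + 1) z) \<le> C * r powr (- (Re s + real (Suc K)))" .
  next
    show "complex_of_real r \<in> S" "complex_of_real (r + 1) \<in> S"
      unfolding S_def by (rule imageI, simp)+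
  qed
  then show ?case by (simp add: C_def)
qed

section \<open>The alternating zeta series and its entire continuation\<close>

lemma summable_Suc_powr: "\<sigma> > 1 \<Longrightarrow> summable (\<lambda>n. real (Suc n) powr (- \<sigma>))"
  by (subst summable_Suc_iff[of "\<lambda>n. real n powr (- \<sigma>)"]) (simp add: summable_real_powr_iff)

definition eta_diff :: "nat \<Rightarrow> complex \<Rightarrow> complex" where
  "eta_diff K s = suminf (\<lambda>n. (-1) ^ n * powr_fdiff K s (of_nat (Suc n)))"

lemma powr_fdiff_local_bound:
  assumes "Re s0 > 1 - real K"
  obtains d M where "d > 0" "cball s0 d \<subseteq> {s. Re s > 1 - real K}" "summable M"
    "\<And>n s. s \<in> cball s0 d \<Longrightarrow> norm ((-1) ^ n * powr_fdiff K s (of_nat (Suc n))) \<le> M n"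
proof -
  \<comment> \<open>Half the distance from s0 to the boundary line, so that the decay exponent Re s
    + K stays above 1 uniformly on the closed disc.\<close>
  define d where "d = (Re s0 - (1 - real K)) / 2"
  define C where "C = (\<Prod>j<K. (norm s0 + d + real j))"
  define M where "M = (\<lambda>n. C * real (Suc n) powr (- (Re s0 - d + real K)))"
  have "d > 0" using assms by (simp add: d_def)
  have sig: "Re s0 - d + real K > 1" using assms by (simp add: d_def field_simps)
  have Re: "Re s \<ge> Re s0 - d" if "s \<in> cball s0 d" for s
  proof -
    have "\<bar>Re (s0 - s)\<bar> \<le> norm (s0 - s)" by (rule abs_Re_le_cmod)
    also have "\<dots> \<le> d" using that by (simp add: dist_norm)
    finally show ?thesis by simp
  qed
  show ?thesis
  proof (rule that[of d M])
    show "cball s0 d \<subseteq> {s. Re s > 1 - real K}" using Re sig by force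
    show "summable M"
      unfolding M_def using sig by (intro summable_mult summable_Suc_powr)
    fix n s assume s: "s \<in> cball s0 d"
    have "norm ((-1) ^ n * powr_fdiff K s (of_nat (Suc n))) = norm (powr_fdiff K s (of_real (real (Suc n))))"
      by (simp add: norm_mult norm_power)
    also have "\<dots> \<le> (\<Prod>j<K. norm (s + of_nat j)) * real (Suc n) powr (- (Re s + real K))"
      using Re[OF s] sig by (intro norm_powr_fdiff_le) auto
    also have "\<dots> \<le> C * real (Suc n) powr (- (Re s0 - d + real K))"
      unfolding C_def
    proof (intro mult_mono prod_mono powr_mono conjI)
      fix j
      have "norm (s + of_nat j) \<le> norm s0 + norm (s - s0) + real j"
        using norm_triangle_ineq[of s "of_nat j"] norm_triangle_ineq2[of s s0] by simp
      then show "norm (s + of_nat j) \<le> norm s0 + d + real j"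
        using s by (simp add: dist_norm norm_minus_commute)
    qed (use Re[OF s] \<open>d > 0\<close> in \<open>auto intro!: prod_nonneg add_nonneg_nonneg\<close>)
    finally show "norm ((-1) ^ n * powr_fdiff K s (of_nat (Suc n))) \<le> M n" by (simp add: M_def)
  qed fact
qed

lemma summable_eta_diff:
  assumes "Re s > 1 - real K"
  shows "summable (\<lambda>n. (-1) ^ n * powr_fdiff K s (of_nat (Suc n)))"
proof -
  obtain d M where d: "d > 0" and M: "summable M"
    and bound: "\<And>n s'. s' \<in> cball s d \<Longrightarrow> norm ((-1) ^ n * powr_fdiff K s' (of_nat (Suc n))) \<le> M n"
    using powr_fdiff_local_bound[OF assms] by metis
  show ?thesis
    by (rule summable_comparison_test'[OF M]) (rule bound, use d in simp)
qed

lemma holomorphic_eta_diff: "eta_diff K holomorphic_on {s. Re s > 1 - real K}"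
proof (rule holomorphic_uniform_sequence[where f = "\<lambda>N s. \<Sum>n<N. (-1) ^ n * powr_fdiff K s (of_nat (Suc n))"])
  show "open {s. Re s > 1 - real K}" by (simp add: open_halfspace_Re_gt)
  show "(\<lambda>s. \<Sum>n<N. (-1) ^ n * powr_fdiff K s (of_nat (Suc n))) holomorphic_on {s. Re s > 1 - real K}" for N
    by (intro holomorphic_intros holomorphic_powr_fdiff) auto
  fix s assume "s \<in> {s. Re s > 1 - real K}"
  then obtain d M where *: "d > 0" "cball s d \<subseteq> {s. Re s > 1 - real K}" "summable M"
    "\<And>n s'. s' \<in> cball s d \<Longrightarrow> norm ((-1) ^ n * powr_fdiff K s' (of_nat (Suc n))) \<le> M n"
    using powr_fdiff_local_bound[of K s] by auto
  have "uniform_limit (cball s d) (\<lambda>N s. \<Sum>n<N. (-1) ^ n * powr_fdiff K s (of_nat (Suc n))) (eta_diff K) sequentially"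
    unfolding eta_diff_def using *(3,4) by (intro Weierstrass_m_test) auto
  with * show "\<exists>d>0. cball s d \<subseteq> {s. Re s > 1 - real K} \<and>
    uniform_limit (cball s d) (\<lambda>N s. \<Sum>n<N. (-1) ^ n * powr_fdiff K s (of_nat (Suc n))) (eta_diff K) sequentially"
    by blast
qed

text \<open>The sign alternates, so a term of the new series is the sum of two consecutive terms of
  the old one. Thus every old term occurs twice, except the first.\<close>

lemma eta_diff_Suc:
  assumes "Re s > 1 - real K"
  shows "eta_diff (Suc K) s = 2 * eta_diff K s - powr_fdiff K s 1"
proof -
  define f where "f = (\<lambda>n. (-1) ^ n * powr_fdiff K s (of_nat (Suc n)))"
  have f: "summable f" unfolding f_def by (rule summable_eta_diff[OF assms])
  have "eta_diff (Suc K) s = suminf (\<lambda>n. f n + f (Suc n))"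
    unfolding eta_diff_def f_def by (intro suminf_cong) (simp add: algebra_simps)
  also have "\<dots> = suminf f + suminf (\<lambda>n. f (Suc n))"
    using f by (intro suminf_add[symmetric]) (auto simp: summable_Suc_iff)
  also have "suminf (\<lambda>n. f (Suc n)) = suminf f - f 0" by (rule suminf_split_head[OF f])
  finally show ?thesis by (simp add: eta_diff_def f_def)
qed

text \<open>Each summation by averaging consecutive terms (Euler's transformation) moves the half-plane
  of convergence of the alternating zeta series one unit to the left.\<close>

definition eta_euler :: "nat \<Rightarrow> complex \<Rightarrow> complex" where
  "eta_euler K s = eta_diff K s / 2 ^ K + (\<Sum>j<K. powr_fdiff j s 1 / 2 ^ Suc j)"

lemma eta_euler_eq:
  assumes "K \<le> L" "Re s > 1 - real K"
  shows "eta_euler L s = eta_euler K s"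
  using assms
proof (induction L rule: dec_induct)
  case (step L)
  then have "eta_euler (Suc L) s = eta_euler L s"
    by (simp add: eta_euler_def eta_diff_Suc diff_divide_distrib)
  with step show ?case by simp
qed simp

text \<open>All K with K > 1 - Re s give the same value by \<open>eta_euler_eq\<close>; the ceiling
  merely selects one such K for each s.\<close>

definition dirichlet_eta :: "complex \<Rightarrow> complex" where
  "dirichlet_eta s = eta_euler (nat \<lceil>2 - Re s\<rceil>) s"

lemma dirichlet_eta_eq:
  assumes "Re s > 1 - real K"
  shows "dirichlet_eta s = eta_euler K s"
proof -
  define L where "L = nat \<lceil>2 - Re s\<rceil>"
  have L: "Re s > 1 - real L" unfolding L_def by linarith
  have "dirichlet_eta s = eta_euler L s" by (simp add: dirichlet_eta_def L_def)
  also have "\<dots> = eta_euler (max K L) s" using L by (intro eta_euler_eq[symmetric]) auto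
  also have "\<dots> = eta_euler K s" using assms by (intro eta_euler_eq) auto
  finally show ?thesis .
qed

lemma holomorphic_dirichlet_eta: "dirichlet_eta holomorphic_on UNIV"
proof -
  have "dirichlet_eta holomorphic_on (\<Union>K. {s. Re s > 1 - real K})"
  proof (rule holomorphic_on_UN_open)
    fix K
    have "eta_euler K holomorphic_on {s. Re s > 1 - real K}"
      unfolding eta_euler_def
      by (intro holomorphic_intros holomorphic_powr_fdiff holomorphic_eta_diff) auto
    then show "dirichlet_eta holomorphic_on {s. Re s > 1 - real K}"
      by (rule holomorphic_transform) (simp add: dirichlet_eta_eq)
  qed (auto simp: open_halfspace_Re_gt)
  also have "(\<Union>K. {s. Re s > 1 - real K}) = UNIV"
  proof (intro equalityI subsetI UNIV_I)
    fix s :: complex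
    obtain K where "1 - Re s < real K" using reals_Archimedean2 by blast
    then show "s \<in> (\<Union>K. {s. Re s > 1 - real K})" by (auto intro!: exI[of _ K])
  qed
  finally show ?thesis .
qed

section \<open>From the alternating series to the Riemann zeta function\<close>

lemma summable_zeta:
  assumes "Re s > 1"
  shows "summable (\<lambda>n. of_nat (Suc n) powr (-s))"
proof (rule summable_comparison_test'[of "\<lambda>n. real (Suc n) powr (-Re s)" 0])
  show "summable (\<lambda>n. real (Suc n) powr (- Re s))" using assms by (rule summable_Suc_powr)
  show "norm (complex_of_nat (Suc n) powr (-s)) \<le> real (Suc n) powr (-Re s)" for n
    using norm_powr_real_powr[of "complex_of_nat (Suc n)" "-s"] by (simp del: of_nat_Suc)
qed

text \<open>Subtracting the alternating series from the zeta series leaves twice the terms with even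
  integers, that is 2 * 2^(-s) times the zeta series.\<close>

lemma dirichlet_eta_eq_zeta:
  assumes "Re s > 1"
  shows "dirichlet_eta s = (1 - 2 powr (1 - s)) * (suminf (\<lambda>n. of_nat (Suc n) powr (-s)))"
proof -
  define a :: "nat \<Rightarrow> complex" where "a = (\<lambda>n. of_nat (Suc n) powr (-s))"
  have a: "summable a" unfolding a_def by (rule summable_zeta[OF assms])
  have "dirichlet_eta s = suminf (\<lambda>n. (-1) ^ n * a n)"
    using dirichlet_eta_eq[of 0 s] assms by (simp add: eta_euler_def eta_diff_def a_def)
  moreover have "summable (\<lambda>n. (-1) ^ n * a n)"
    using summable_eta_diff[of 0 s] assms by (simp add: a_def)
  ultimately have "(\<lambda>n. a n - (-1) ^ n * a n) sums (suminf a - dirichlet_eta s)"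
    using sums_diff summable_sums a by metis
  \<comment> \<open>Index n stands for the integer n + 1, so the even integers sit at the odd
    indices.\<close>
  also have "?this \<longleftrightarrow> (\<lambda>n. a (2 * n + 1) - (-1) ^ (2 * n + 1) * a (2 * n + 1)) sums (suminf a - dirichlet_eta s)"
  proof (rule sums_mono_reindex[symmetric])
    show "strict_mono (\<lambda>n. 2 * n + 1 :: nat)" by (auto simp: strict_mono_def)
    fix n assume "n \<notin> range (\<lambda>n. 2 * n + 1 :: nat)"
    then have "even n" by (metis oddE rangeI)
    then show "a n - (-1) ^ n * a n = 0" by simp
  qed
  also have "(\<lambda>n. a (2 * n + 1) - (-1) ^ (2 * n + 1) * a (2 * n + 1)) = (\<lambda>n. 2 powr (1 - s) * a n)"
  proof
    fix n
    have "a (2 * n + 1) = (2 * of_nat (Suc n)) powr (-s)"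
      unfolding a_def by (simp add: algebra_simps)
    also have "\<dots> = 2 powr (-s) * a n"
      unfolding a_def using powr_times_real[of 2 "of_nat (Suc n)" "-s"] by (simp del: of_nat_Suc)
    finally show "a (2 * n + 1) - (-1) ^ (2 * n + 1) * a (2 * n + 1) = 2 powr (1 - s) * a n"
      by (simp add: powr_diff powr_minus field_simps)
  qed
  finally have "suminf a - dirichlet_eta s = 2 powr (1 - s) * suminf a"
    using sums_unique2 sums_mult[OF summable_sums[OF a]] by blast
  then show ?thesis by (simp add: a_def algebra_simps)
qed

text \<open>The choice operator yields the Dirichlet series only once a witness exists. The witness
  is eta(s) / (1 - 2^(1-s)), meromorphic on the plane; \<open>remove_sings\<close> normalises it to
  a nicely meromorphic function.\<close>

lemma riemann_zeta_eq:
  assumes "Re s > 1"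
  shows "riemann_zeta s = suminf (\<lambda>n. of_nat (Suc n) powr (-s))"
proof -
  define f where "f = (\<lambda>s. dirichlet_eta s / (1 - 2 powr (1 - s)))"
  have eq: "(\<lambda>n. 1 / of_nat (Suc n) powr s) = (\<lambda>n. of_nat (Suc n) powr (-s))" for s :: complex
    by (simp add: powr_minus field_simps)
  have holo: "dirichlet_eta analytic_on A" for A
    using holomorphic_dirichlet_eta analytic_on_open open_UNIV analytic_on_subset by blast
  have "f meromorphic_on UNIV"
    unfolding f_def
    by (intro meromorphic_intros analytic_on_imp_meromorphic_on holo analytic_intros) auto
  then have "remove_sings f nicely_meromorphic_on UNIV"
    by (rule remove_sings_nicely_meromorphic)
  moreover have "remove_sings f s = suminf (\<lambda>n. 1 / of_nat (Suc n) powr s)" if "Re s > 1" for s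
  proof -
    \<comment> \<open>The denominator has no zero for Re s > 1, so \<open>remove_sings\<close>
      leaves the quotient unchanged there.\<close>
    have "norm (2 powr (1 - s)) < 1"
      using that norm_powr_real_powr[of 2 "1 - s"] by (simp add: powr_less_one)
    then have nz: "1 - 2 powr (1 - s) \<noteq> 0" by auto
    then have "f analytic_on {s}"
      unfolding f_def by (intro analytic_intros holo) auto
    then show ?thesis
      using nz that by (simp add: f_def dirichlet_eta_eq_zeta eq del: of_nat_Suc)
  qed
  ultimately have "\<exists>f. f nicely_meromorphic_on UNIV \<and>
        (\<forall>s. Re s > 1 \<longrightarrow> f s = suminf (\<lambda>n. 1 / of_nat (Suc n) powr s))" by blast
  from someI_ex[OF this]
  have "\<forall>s. Re s > 1 \<longrightarrow> riemann_zeta s = suminf (\<lambda>n. 1 / of_nat (Suc n) powr s)"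
    unfolding riemann_zeta_def[symmetric] by (rule conjunct2)
  with assms show ?thesis by (simp add: eq del: of_nat_Suc)
qed

text \<open>Dominated convergence for series: the terms are (2/(n+2))^s, of which the first is 1 and
  the others tend to 0. Once Re s \<ge> 2 they are dominated by (2/(n+2))^2.\<close>

lemma riemann_zeta_asymp:
  assumes "filterlim (\<lambda>k. Re (s k)) at_top F" "F \<noteq> bot"
  shows "((\<lambda>k. 2 powr s k * (riemann_zeta (s k) - 1)) \<longlongrightarrow> 1) F"
proof -
  define a where "a = (\<lambda>n k. 2 powr s k * of_nat (n + 2) powr (- s k))"
  have norm_a: "norm (a n k) = (2 / real (n + 2)) powr Re (s k)" for n k
  proof -
    have "norm (of_nat (n + 2) powr (- s k)) = real (n + 2) powr (- Re (s k))"
      using norm_powr_real_powr[of "of_nat (n + 2)" "- s k"] by (simp del: of_nat_add)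
    moreover have "norm (2 powr s k) = 2 powr Re (s k)"
      using norm_powr_real_powr[of 2 "s k"] by simp
    ultimately show ?thesis
      unfolding a_def norm_mult by (simp add: powr_divide powr_minus_divide)
  qed
  have "((\<lambda>k. suminf (\<lambda>n. a n k)) \<longlongrightarrow> (suminf (\<lambda>n. if n = 0 then 1 else 0))) F"
  proof (rule tannerys_theorem[THEN conjunct2, THEN conjunct2])
    show "((\<lambda>k. a n k) \<longlongrightarrow> (if n = 0 then 1 else 0)) F" for n
    proof (cases "n = 0")
      case True
      then show ?thesis by (simp add: a_def flip: powr_add)
    next
      case False
      then have "((\<lambda>x. (2 / real (n + 2)) powr x) \<longlongrightarrow> 0) at_top"
        by (simp add: powr_def) real_asymp
      then have "((\<lambda>k. norm (a n k)) \<longlongrightarrow> 0) F"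
        unfolding norm_a by (rule filterlim_compose) fact
      with False show ?thesis by (simp add: tendsto_norm_zero_iff)
    qed
    have "\<forall>\<^sub>F k in F. Re (s k) \<ge> 2" using assms(1) by (simp add: filterlim_at_top)
    then have "\<forall>\<^sub>F k in F. \<forall>n. norm (a n k) \<le> (2 / real (n + 2)) powr 2"
      by eventually_elim (intro allI, unfold norm_a, rule powr_mono', auto)
    then show "\<forall>\<^sub>F (n, k) in sequentially \<times>\<^sub>F F. norm (a n k) \<le> (2 / real (n + 2)) powr 2"
      unfolding eventually_prod_filter case_prod_conv by (intro exI[of _ "\<lambda>_. True"] exI conjI) auto
    have "summable (\<lambda>n. 4 * real (n + 2) powr (-2))"
      by (intro summable_mult) (subst summable_iff_shift[of "\<lambda>n. real n powr (-2)"], simp add: summable_real_powr_iff)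
    also have "(\<lambda>n. 4 * real (n + 2) powr (-2)) = (\<lambda>n. (2 / real (n + 2)) powr 2)"
      by (simp add: powr_divide powr_minus field_simps)
    finally show "summable (\<lambda>n. (2 / real (n + 2)) powr 2)" .
  qed fact
  moreover have "suminf (\<lambda>n. if n = 0 then 1 else 0) = (1 :: complex)"
    using suminf_finite[of "{0}" "\<lambda>n. if n = 0 then 1 else 0 :: complex"] by simp
  moreover have "\<forall>\<^sub>F k in F. suminf (\<lambda>n. a n k) = 2 powr s k * (riemann_zeta (s k) - 1)"
  proof -
    have "\<forall>\<^sub>F k in F. Re (s k) > 1" using assms(1) by (simp add: filterlim_at_top_dense)
    then show ?thesis
    proof eventually_elim
      case (elim k)
      have "riemann_zeta (s k) - 1 = suminf (\<lambda>n. of_nat (Suc (Suc n)) powr (- s k))"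
        using suminf_split_head[OF summable_zeta[OF elim]] riemann_zeta_eq[OF elim] by simp
      also have "2 powr s k * \<dots> = suminf (\<lambda>n. a n k)"
      proof -
        have "summable (\<lambda>n. complex_of_nat (Suc (Suc n)) powr (- s k))"
          using summable_zeta[OF elim] summable_Suc_iff[of "\<lambda>n. complex_of_nat (Suc n) powr (- s k)"]
          by blast
        from suminf_mult[OF this, of "2 powr s k"] show ?thesis by (simp add: a_def)
      qed
      finally show ?case by simp
    qed
  qed
  ultimately show ?thesis by (auto elim: Lim_transform_eventually)
qed

section \<open>The Weierstrass functions of a lattice\<close>

text \<open>The M-test gives uniform convergence along the net of finite subsets, and locally
  uniform limits of holomorphic functions may be differentiated termwise. The net replaces a
  sequence because the lattice is never enumerated.\<close>

lemma has_sum_termwise_derivative: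
  fixes f :: "'a \<Rightarrow> complex \<Rightarrow> complex"
  assumes "open A" "z \<in> A"
    and f': "\<And>x w. x \<in> X \<Longrightarrow> w \<in> A \<Longrightarrow> (f x has_field_derivative f' x w) (at w)"
    and bound: "\<And>x w. x \<in> X \<Longrightarrow> w \<in> A \<Longrightarrow> norm (f x w) \<le> M x"
    and "M summable_on X"
  obtains g' where "((\<lambda>w. \<Sum>\<^sub>\<infinity>x\<in>X. f x w) has_field_derivative g') (at z)"
    "((\<lambda>x. f' x z) has_sum g') X"
proof -
  obtain r where r: "r > 0" "cball z r \<subseteq> A"
    using assms(1,2) open_contains_cball by blast
  have sub: "\<forall>\<^sub>F F in finite_subsets_at_top X. finite F \<and> F \<subseteq> X"
    by (simp add: eventually_finite_subsets_at_top_weakI)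
  have ev: "\<forall>\<^sub>F F in finite_subsets_at_top X. continuous_on (cball z r) (\<lambda>w. \<Sum>x\<in>F. f x w) \<and>
      (\<forall>w\<in>ball z r. ((\<lambda>w. \<Sum>x\<in>F. f x w) has_field_derivative (\<Sum>x\<in>F. f' x w)) (at w))"
    using sub
  proof eventually_elim
    case (elim F)
    have "((\<lambda>w. \<Sum>x\<in>F. f x w) has_field_derivative (\<Sum>x\<in>F. f' x w)) (at w)" if "w \<in> cball z r" for w
      using elim that r by (intro DERIV_sum f') auto
    then show ?case
      by (auto intro!: continuous_at_imp_continuous_on DERIV_isCont)
  qed
  have "uniform_limit A (\<lambda>F w. \<Sum>x\<in>F. f x w) (\<lambda>w. \<Sum>\<^sub>\<infinity>x\<in>X. f x w) (finite_subsets_at_top X)"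
    using bound assms(5) by (rule Weierstrass_m_test_general)
  then have "uniform_limit (cball z r) (\<lambda>F w. \<Sum>x\<in>F. f x w) (\<lambda>w. \<Sum>\<^sub>\<infinity>x\<in>X. f x w) (finite_subsets_at_top X)"
    using r(2) by (rule uniform_limit_on_subset)
  from has_complex_derivative_uniform_limit[OF ev this finite_subsets_at_top_neq_bot r(1)]
  obtain g' where "\<And>w. w \<in> ball z r \<Longrightarrow> ((\<lambda>w. \<Sum>\<^sub>\<infinity>x\<in>X. f x w) has_field_derivative g' w) (at w) \<and>
      ((\<lambda>F. \<Sum>x\<in>F. f' x w) \<longlongrightarrow> g' w) (finite_subsets_at_top X)" by metis
  then show ?thesis using that[of "g' z"] r(1) by (auto simp: has_sum_def)
qed

text \<open>The Weierstrass elementary factor E_2 at z / \<omega>. It differs from 1 by a term of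
  third order, which matches the convergence of the sum of |\<omega>|^(-3).\<close>

definition sigma_factor :: "complex \<Rightarrow> complex \<Rightarrow> complex" where
  "sigma_factor \<omega> z = (1 - z / \<omega>) * exp (z / \<omega> + z\<^sup>2 / (2 * \<omega>\<^sup>2))"

text \<open>For \<open>\<omega> = 0\<close> the convention \<open>x / 0 = 0\<close> turns the next two summands into \<open>1 / z\<close> and
  \<open>1 / z\<^sup>2\<close>, so that the series of \<open>\<zeta>\<close> and \<open>\<wp>\<close> extend over the whole lattice.\<close>

definition zeta_summand :: "complex \<Rightarrow> complex \<Rightarrow> complex" where
  "zeta_summand \<omega> z = 1 / (z - \<omega>) + 1 / \<omega> + z / \<omega>\<^sup>2"

definition p_summand :: "complex \<Rightarrow> complex \<Rightarrow> complex" where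
  "p_summand \<omega> z = 1 / (z - \<omega>)\<^sup>2 - 1 / \<omega>\<^sup>2"

lemma sigma_factor_eq_0_iff: "\<omega> \<noteq> 0 \<Longrightarrow> sigma_factor \<omega> z = 0 \<longleftrightarrow> z = \<omega>"
  by (auto simp: sigma_factor_def)

lemma has_field_derivative_sigma_factor:
  assumes "\<omega> \<noteq> 0" "z \<noteq> \<omega>"
  shows "(sigma_factor \<omega> has_field_derivative sigma_factor \<omega> z * zeta_summand \<omega> z) (at z)"
proof -
  have "((\<lambda>z. z / \<omega> + z\<^sup>2 / (2 * \<omega>\<^sup>2)) has_field_derivative 1 / \<omega> + z / \<omega>\<^sup>2) (at z)"
    using assms by (auto intro!: derivative_eq_intros simp: power2_eq_square power4_eq_xxxx)
  note exp = DERIV_chain2[OF DERIV_exp this]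
  have "((\<lambda>z. 1 - z / \<omega>) has_field_derivative - (1 / \<omega>)) (at z)"
    using assms by (auto intro!: derivative_eq_intros)
  \<comment> \<open>Written as a multiple of the linear factor, so that the product rule produces a
    logarithmic derivative.\<close>
  also have "- (1 / \<omega>) = (1 - z / \<omega>) * (1 / (z - \<omega>))"
    using assms by (simp add: field_simps)
  finally have "((\<lambda>z. 1 - z / \<omega>) has_field_derivative (1 - z / \<omega>) * (1 / (z - \<omega>))) (at z)" .
  from DERIV_mult[OF this exp] show ?thesis
    unfolding sigma_factor_def[abs_def] zeta_summand_def
    by (rule DERIV_cong) (simp only: distrib_left distrib_right mult_ac add_ac)
qed

lemma has_field_derivative_zeta_summand:
  assumes "z \<noteq> \<omega>"
  shows "(zeta_summand \<omega> has_field_derivative - p_summand \<omega> z) (at z)"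
proof -
  have "((\<lambda>z. 1 / (z - \<omega>)) has_field_derivative - (1 / (z - \<omega>)\<^sup>2)) (at z)"
    using assms by (auto intro!: derivative_eq_intros simp: power2_eq_square)
  from DERIV_add[OF DERIV_add[OF this DERIV_const] DERIV_cdivide[OF DERIV_ident]] show ?thesis
    unfolding zeta_summand_def[abs_def] by (rule DERIV_cong) (simp add: p_summand_def)
qed

text \<open>The condition 2R \<le> |\<omega>| gives |z / \<omega>| \<le> 1/2, where |E_2(u) - 1|
  \<le> 3 |u|^3. As 3/8 < 1/2, the factor is within the range of the bound for \<open>Ln\<close>
  near 1.\<close>

lemma norm_sigma_factor_minus_1:
  assumes "norm z < R" "2 * R \<le> norm \<omega>"
  shows "norm (sigma_factor \<omega> z - 1) \<le> 3 * R ^ 3 * (1 / norm \<omega> ^ 3)"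
    and "norm (sigma_factor \<omega> z - 1) < 1 / 2"
proof -
  have "R > 0" using assms(1) norm_ge_zero[of z] by linarith
  have \<omega>: "norm \<omega> > 0" using assms \<open>R > 0\<close> by linarith
  have eq: "sigma_factor \<omega> z = weierstrass_factor 2 (z / \<omega>)"
    by (simp add: sigma_factor_def weierstrass_factor_def eval_nat_numeral mult_ac)
  have *: "norm (z / \<omega>) \<le> 1 / 2"
    using assms \<omega> by (simp add: norm_divide field_simps)
  have bound: "norm (sigma_factor \<omega> z - 1) \<le> 3 * norm (z / \<omega>) ^ 3"
    using weierstrass_factor_bound[OF *, of 2] by (simp add: eq)
  also have "\<dots> \<le> 3 * (1 / 2) ^ 3"
    using * by (intro mult_left_mono power_mono) auto
  finally show "norm (sigma_factor \<omega> z - 1) < 1 / 2" by (simp add: power3_eq_cube)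
  have "norm (z / \<omega>) ^ 3 \<le> (R / norm \<omega>) ^ 3"
    using assms by (intro power_mono) (auto simp: norm_divide divide_right_mono)
  with bound show "norm (sigma_factor \<omega> z - 1) \<le> 3 * R ^ 3 * (1 / norm \<omega> ^ 3)"
    by (simp add: power_divide)
qed

text \<open>The three fractions combine to z^2 / (\<omega>^2 (z - \<omega>)), and |z - \<omega>|
  \<ge> |\<omega>| / 2.\<close>

lemma norm_zeta_summand:
  assumes "norm z < R" "2 * R \<le> norm \<omega>"
  shows "norm (zeta_summand \<omega> z) \<le> 2 * R ^ 2 * (1 / norm \<omega> ^ 3)"
proof -
  have "R > 0" using assms(1) norm_ge_zero[of z] by linarith
  have \<omega>: "norm \<omega> > 0" using assms \<open>R > 0\<close> by linarith
  have dist: "norm \<omega> / 2 \<le> norm (z - \<omega>)"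
    using norm_triangle_ineq2[of \<omega> z] assms by (simp add: norm_minus_commute)
  then have "z \<noteq> \<omega>" "\<omega> \<noteq> 0" using \<omega> by auto
  then have "zeta_summand \<omega> z = z\<^sup>2 / (\<omega>\<^sup>2 * (z - \<omega>))"
    by (simp add: zeta_summand_def divide_simps) (simp add: algebra_simps power2_eq_square)
  then have "norm (zeta_summand \<omega> z) = norm z ^ 2 / (norm \<omega> ^ 2 * norm (z - \<omega>))"
    by (simp add: norm_divide norm_mult norm_power)
  also have "\<dots> \<le> R ^ 2 / (norm \<omega> ^ 2 * (norm \<omega> / 2))"
    using assms dist \<omega> by (intro frac_le power_mono mult_left_mono) auto
  also have "\<dots> = 2 * R ^ 2 * (1 / norm \<omega> ^ 3)"
    by (simp add: power2_eq_square power3_eq_cube)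
  finally show ?thesis .
qed

section \<open>Lattices and the convergence of lattice sums\<close>

lemma summable_on_int_powr: "(\<lambda>m::int. (1 + real_of_int \<bar>m\<bar>) powr (-3/2)) summable_on UNIV"
proof -
  let ?f = "\<lambda>m::int. (1 + real_of_int \<bar>m\<bar>) powr (-3/2)"
  have "summable (\<lambda>n. real (Suc n) powr (-3/2))"
    using summable_Suc_powr[of "3/2"] by simp
  then have *: "(\<lambda>n. real (Suc n) powr (-3/2)) summable_on UNIV"
    by (rule summable_nonneg_imp_summable_on) simp
  have "?f summable_on range int"
    using * by (subst summable_on_reindex) (auto simp: o_def)
  moreover have "?f summable_on range (\<lambda>n. - int n)"
    using * by (subst summable_on_reindex) (auto simp: o_def inj_on_def)
  ultimately have "?f summable_on (range int \<union> range (\<lambda>n. - int n))"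
    by (rule summable_on_union)
  also have "range int \<union> range (\<lambda>n. - int n) = UNIV"
    by (metis (no_types, lifting) UNIV_eq_I Un_iff int_cases2 rangeI)
  finally show ?thesis .
qed

text \<open>Up to sign, \<open>Im (\<omega>1 * cnj \<omega>2)\<close> is the area of the period
  parallelogram. As the determinant of the basis it serves directly in every application of Cramer's
  rule below.\<close>

locale lattice_basis =
  fixes \<Omega> :: "complex set" and \<omega>1 \<omega>2 :: complex
  assumes lattice_eq: "\<Omega> = {of_int m * \<omega>1 + of_int n * \<omega>2 | m n. True}"
    and Im_nonzero: "Im (\<omega>1 * cnj \<omega>2) \<noteq> 0"
begin

lemma zero_mem: "0 \<in> \<Omega>"
  unfolding lattice_eq by (auto intro!: exI[of _ 0])

lemma basis_mem: "\<omega>1 \<in> \<Omega>" "\<omega>2 \<in> \<Omega>"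
proof -
  have "\<omega>1 = of_int 1 * \<omega>1 + of_int 0 * \<omega>2" "\<omega>2 = of_int 0 * \<omega>1 + of_int 1 * \<omega>2" by simp_all
  then show "\<omega>1 \<in> \<Omega>" "\<omega>2 \<in> \<Omega>" unfolding lattice_eq by blast+
qed

lemma add_mem: "a \<in> \<Omega> \<Longrightarrow> b \<in> \<Omega> \<Longrightarrow> a + b \<in> \<Omega>"
proof -
  assume "a \<in> \<Omega>" "b \<in> \<Omega>"
  then obtain m n m' n' where "a = of_int m * \<omega>1 + of_int n * \<omega>2" "b = of_int m' * \<omega>1 + of_int n' * \<omega>2"
    unfolding lattice_eq by blast
  then have "a + b = of_int (m + m') * \<omega>1 + of_int (n + n') * \<omega>2" by (simp add: algebra_simps)
  then show ?thesis unfolding lattice_eq by blast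
qed

lemma minus_mem: "a \<in> \<Omega> \<Longrightarrow> - a \<in> \<Omega>"
proof -
  assume "a \<in> \<Omega>"
  then obtain m n where "a = of_int m * \<omega>1 + of_int n * \<omega>2"
    unfolding lattice_eq by blast
  then have "- a = of_int (- m) * \<omega>1 + of_int (- n) * \<omega>2" by (simp add: algebra_simps)
  then show ?thesis unfolding lattice_eq by blast
qed

lemma diff_mem: "a \<in> \<Omega> \<Longrightarrow> b \<in> \<Omega> \<Longrightarrow> a - b \<in> \<Omega>"
  using add_mem[of a "- b"] minus_mem[of b] by simp

lemma of_nat_mult_mem: "a \<in> \<Omega> \<Longrightarrow> of_nat k * a \<in> \<Omega>"
  by (induction k) (auto simp: zero_mem add_mem algebra_simps)

lemma minus_mem_iff: "- a \<in> \<Omega> \<longleftrightarrow> a \<in> \<Omega>"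
  by (metis minus_mem minus_minus)

lemma add_mem_iff: "b \<in> \<Omega> \<Longrightarrow> a + b \<in> \<Omega> \<longleftrightarrow> a \<in> \<Omega>"
  by (metis add_mem diff_mem add_diff_cancel_right')

lemma countable_lattice: "countable \<Omega>"
proof -
  have "\<Omega> = (\<lambda>(m, n). of_int m * \<omega>1 + of_int n * \<omega>2) ` (UNIV :: (int \<times> int) set)"
    unfolding lattice_eq by auto
  then show ?thesis by (metis countable_image countableI_type)
qed

text \<open>Pairing v with cnj \<omega>2 or cnj \<omega>1 and taking imaginary parts isolates m or
  n, up to sign, times the determinant D, while the pairing is at most |v| N. Hence c = D /
  N.\<close>

lemma norm_lattice_lower_bound:
  obtains c where "c > 0"
    "\<And>m n. c * real_of_int \<bar>m\<bar> \<le> norm (of_int m * \<omega>1 + of_int n * \<omega>2)"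
    "\<And>m n. c * real_of_int \<bar>n\<bar> \<le> norm (of_int m * \<omega>1 + of_int n * \<omega>2)"
proof -
  define D where "D = \<bar>Im (\<omega>1 * cnj \<omega>2)\<bar>"
  define N where "N = norm \<omega>1 + norm \<omega>2"
  have D: "D > 0" using Im_nonzero by (simp add: D_def)
  have N: "N > 0" using Im_nonzero by (cases "\<omega>1 = 0") (auto simp: N_def add_pos_nonneg)
  show ?thesis
  proof (rule that[of "D / N"])
    show "D / N > 0" using D N by simp
    fix m n
    define v where "v = of_int m * \<omega>1 + of_int n * \<omega>2"
    have le: "\<bar>Im (v * cnj w)\<bar> \<le> norm v * N" if "norm w \<le> N" for w
    proof -
      have "\<bar>Im (v * cnj w)\<bar> \<le> norm v * norm w"
        using abs_Im_le_cmod[of "v * cnj w"] by (simp add: norm_mult)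
      also have "\<dots> \<le> norm v * N" using that by (intro mult_left_mono) auto
      finally show ?thesis .
    qed
    have "Im (v * cnj \<omega>2) = of_int m * Im (\<omega>1 * cnj \<omega>2)" "Im (v * cnj \<omega>1) = - of_int n * Im (\<omega>1 * cnj \<omega>2)"
      by (simp_all add: v_def algebra_simps)
    then have "real_of_int \<bar>m\<bar> * D \<le> norm v * N" "real_of_int \<bar>n\<bar> * D \<le> norm v * N"
      using le[of \<omega>2] le[of \<omega>1] by (simp_all add: N_def D_def abs_mult)
    then show "D / N * real_of_int \<bar>m\<bar> \<le> norm v" "D / N * real_of_int \<bar>n\<bar> \<le> norm v"
      using N by (simp_all add: field_simps)
  qed
qed

lemma finite_lattice_ball: "finite {\<omega> \<in> \<Omega>. norm \<omega> < r}"
proof -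
  obtain c where c: "c > 0"
    "\<And>m n. c * real_of_int \<bar>m\<bar> \<le> norm (of_int m * \<omega>1 + of_int n * \<omega>2)"
    "\<And>m n. c * real_of_int \<bar>n\<bar> \<le> norm (of_int m * \<omega>1 + of_int n * \<omega>2)"
    using norm_lattice_lower_bound by blast
  define K where "K = \<lceil>r / c\<rceil>"
  have "{\<omega> \<in> \<Omega>. norm \<omega> < r} \<subseteq> (\<lambda>(m, n). of_int m * \<omega>1 + of_int n * \<omega>2) ` ({-K..K} \<times> {-K..K})"
  proof
    fix v assume "v \<in> {\<omega> \<in> \<Omega>. norm \<omega> < r}"
    then obtain m n where v: "v = of_int m * \<omega>1 + of_int n * \<omega>2" "norm v < r"
      unfolding lattice_eq by blast
    have mem: "k \<in> {-K..K}" if "c * real_of_int \<bar>k\<bar> \<le> norm v" for k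
    proof -
      have "real_of_int \<bar>k\<bar> \<le> r / c" using that v(2) c(1) by (simp add: field_simps)
      then have "\<bar>k\<bar> \<le> K" unfolding K_def by linarith
      then show ?thesis by auto
    qed
    have "m \<in> {-K..K}" "n \<in> {-K..K}"
      using c(2)[of m n] c(3)[of n m] by (auto simp only: v(1) intro!: mem)
    then show "v \<in> (\<lambda>(m, n). of_int m * \<omega>1 + of_int n * \<omega>2) ` ({-K..K} \<times> {-K..K})"
      unfolding v(1) by (intro image_eqI[of _ _ "(m, n)"]) auto
  qed
  then show ?thesis by (rule finite_subset) auto
qed

text \<open>Off the origin |v| is at least c/2 times both 1 + |m| and 1 + |n|. Giving each bound
  half of the exponent 3 dominates the double sum by a product of two convergent single sums with
  exponent 3/2; the constant is (2/c)^3.\<close>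

lemma summable_on_inverse_cube: "(\<lambda>\<omega>. 1 / norm \<omega> ^ 3) summable_on \<Omega>"
proof -
  obtain c where c: "c > 0"
    "\<And>m n. c * real_of_int \<bar>m\<bar> \<le> norm (of_int m * \<omega>1 + of_int n * \<omega>2)"
    "\<And>m n. c * real_of_int \<bar>n\<bar> \<le> norm (of_int m * \<omega>1 + of_int n * \<omega>2)"
    using norm_lattice_lower_bound by blast
  define v :: "int \<times> int \<Rightarrow> complex" where "v = (\<lambda>(m, n). of_int m * \<omega>1 + of_int n * \<omega>2)"
  define h :: "int \<Rightarrow> real" where "h = (\<lambda>m. (1 + real_of_int \<bar>m\<bar>) powr (-3/2))"
  have "(\<lambda>(m, n). h m * h n) summable_on UNIV \<times> UNIV"
  proof (rule summable_on_SigmaI)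
    show "((\<lambda>n. case (m, n) of (m, n) \<Rightarrow> h m * h n) has_sum h m * infsum h UNIV) UNIV" for m
      using summable_on_int_powr by (auto intro!: has_sum_cmult_right simp: h_def)
    show "(\<lambda>m. h m * infsum h UNIV) summable_on UNIV"
      using summable_on_int_powr by (intro summable_on_cmult_left) (simp add: h_def)
  qed (simp add: h_def)
  then have "(\<lambda>x. (8 / c ^ 3) * (case x of (m, n) \<Rightarrow> h m * h n)) summable_on UNIV"
    by (intro summable_on_cmult_right) simp
  then have "(\<lambda>x. 1 / norm (v x) ^ 3) summable_on UNIV"
  proof (rule summable_on_comparison_test)
    fix x :: "int \<times> int"
    obtain m n where x: "x = (m, n)" by fastforce
    show "1 / norm (v x) ^ 3 \<le> (8 / c ^ 3) * (case x of (m, n) \<Rightarrow> h m * h n)"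
    proof (cases "x = (0, 0)")
      \<comment> \<open>At the origin the summand 1 / 0 is 0 by convention.\<close>
      case True
      then show ?thesis using c(1) by (simp add: v_def h_def)
    next
      case False
      have ge: "c / 2 * (1 + real_of_int \<bar>k\<bar>) \<le> norm (v x)" if "k = m \<or> k = n" for k
      proof (cases "k = 0")
        case True
        \<comment> \<open>If the chosen coordinate is 0, the other one is a nonzero integer and
          already gives |v| \<ge> c.\<close>
        have "c * 1 \<le> c * max (real_of_int \<bar>m\<bar>) (real_of_int \<bar>n\<bar>)"
          using False x c(1) by (intro mult_left_mono) (auto simp: max_def)
        also have "\<dots> \<le> norm (v x)"
          using c(2)[of m n] c(3)[of n m] by (auto simp: v_def x max_def)
        finally show ?thesis using True c(1) by simp
      next
        case k: False
        have "c / 2 * (1 + real_of_int \<bar>k\<bar>) \<le> c / 2 * (2 * real_of_int \<bar>k\<bar>)"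
          using k c(1) by (intro mult_left_mono) auto
        also have "\<dots> \<le> norm (v x)"
          using c(2)[of m n] c(3)[of n m] that by (auto simp: v_def x)
        finally show ?thesis .
      qed
      have pos: "norm (v x) > 0" using ge[of m] c(1) by (smt (verit, best) mult_pos_pos half_gt_zero of_int_0_le_iff abs_ge_zero)
      define y where "y = 2 * norm (v x) / c"
      have y: "1 + real_of_int \<bar>m\<bar> \<le> y" "1 + real_of_int \<bar>n\<bar> \<le> y" "y > 0"
        using ge[of m] ge[of n] c(1) pos by (simp_all add: y_def field_simps)
      have "1 / y ^ 3 = y powr (-3/2) * y powr (-3/2)"
        using y(3) by (simp add: powr_minus_divide flip: powr_add powr_numeral)
      also have "\<dots> \<le> h m * h n"
        unfolding h_def using y by (intro mult_mono powr_mono2') auto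
      finally have "(8 / c ^ 3) * (1 / y ^ 3) \<le> (8 / c ^ 3) * (h m * h n)"
        using c(1) by (intro mult_left_mono) auto
      moreover have "1 / norm (v x) ^ 3 = (8 / c ^ 3) * (1 / y ^ 3)"
        using c(1) pos by (simp add: y_def power3_eq_cube field_simps)
      ultimately show ?thesis by (simp add: x)
    qed
  qed simp
  moreover have "inj v"
  proof (rule injI, clarify)
    fix m n m' n' assume "v (m, n) = v (m', n')"
    then have "of_int (m - m') * \<omega>1 + of_int (n - n') * \<omega>2 = 0" by (simp add: v_def algebra_simps)
    then have "c * real_of_int \<bar>m - m'\<bar> \<le> 0" "c * real_of_int \<bar>n - n'\<bar> \<le> 0"
      using c(2,3)[where m="m - m'" and n="n - n'"] by simp_all
    then show "m = m' \<and> n = n'" using c(1) by (simp add: mult_le_0_iff)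
  qed
  ultimately have "(\<lambda>\<omega>. 1 / norm \<omega> ^ 3) summable_on range v"
    by (subst summable_on_reindex) (auto simp: o_def)
  also have "range v = \<Omega>" unfolding lattice_eq v_def by auto
  finally show ?thesis .
qed

text \<open>For |z| < R all zeros of factors lie in the finite part \<open>near R\<close>. The
  factors of \<open>far R\<close> stay close to 1, so their logarithms can be summed.\<close>

definition near :: "real \<Rightarrow> complex set" where "near R = {\<omega> \<in> \<Omega>. norm \<omega> < 2 * R}"
definition far :: "real \<Rightarrow> complex set" where "far R = {\<omega> \<in> \<Omega>. 2 * R \<le> norm \<omega>}"

lemma finite_near: "finite (near R)" unfolding near_def by (rule finite_lattice_ball)
lemma near_Un_far: "near R \<union> far R = \<Omega>" and near_Int_far: "near R \<inter> far R = {}"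
  by (auto simp: near_def far_def)

lemma summable_on_far: "(\<lambda>\<omega>. C * (1 / norm \<omega> ^ 3)) summable_on far R"
proof -
  have "far R \<subseteq> \<Omega>" by (auto simp: far_def)
  then show ?thesis
    by (intro summable_on_cmult_right summable_on_subset_banach[OF summable_on_inverse_cube])
qed

text \<open>Being within 1/2 of 1, the factor has positive real part and avoids the branch cut of
  \<open>Ln\<close>.\<close>

lemma Ln_sigma_factor:
  assumes "norm z < R" "\<omega> \<in> far R"
  shows "norm (Ln (sigma_factor \<omega> z)) \<le> 6 * R ^ 3 * (1 / norm \<omega> ^ 3)"
    and "((\<lambda>z. Ln (sigma_factor \<omega> z)) has_field_derivative zeta_summand \<omega> z) (at z)"
    and "exp (Ln (sigma_factor \<omega> z)) = sigma_factor \<omega> z"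
proof -
  have \<omega>: "2 * R \<le> norm \<omega>" using assms by (simp add: far_def)
  have "R > 0" using assms(1) norm_ge_zero[of z] by linarith
  then have nz: "\<omega> \<noteq> 0" "z \<noteq> \<omega>" using assms(1) \<omega> by auto
  note b = norm_sigma_factor_minus_1[OF assms(1) \<omega>]
  have "norm (Ln (sigma_factor \<omega> z)) \<le> 2 * norm (sigma_factor \<omega> z - 1)"
    using norm_Ln_le[OF b(2)] by simp
  with b(1) show "norm (Ln (sigma_factor \<omega> z)) \<le> 6 * R ^ 3 * (1 / norm \<omega> ^ 3)" by simp
  have "\<bar>Re (sigma_factor \<omega> z) - 1\<bar> < 1 / 2"
    using b(2) abs_Re_le_cmod[of "sigma_factor \<omega> z - 1"] by simp
  then have "Re (sigma_factor \<omega> z) > 0" by linarith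
  then have "sigma_factor \<omega> z \<notin> \<real>\<^sub>\<le>\<^sub>0" by (auto simp: complex_nonpos_Reals_iff)
  moreover have "sigma_factor \<omega> z \<noteq> 0" using nz by (simp add: sigma_factor_eq_0_iff)
  ultimately show "((\<lambda>z. Ln (sigma_factor \<omega> z)) has_field_derivative zeta_summand \<omega> z) (at z)"
    "exp (Ln (sigma_factor \<omega> z)) = sigma_factor \<omega> z"
    using nz by (auto intro!: derivative_eq_intros has_field_derivative_sigma_factor)
qed

section \<open>Sigma, zeta and p as finite expressions combined with convergent tails\<close>

definition log_tail :: "real \<Rightarrow> complex \<Rightarrow> complex" where
  "log_tail R z = (\<Sum>\<^sub>\<infinity>\<omega>\<in>far R. Ln (sigma_factor \<omega> z))"

definition near_product :: "real \<Rightarrow> complex \<Rightarrow> complex" where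
  "near_product R z = (\<Prod>\<omega>\<in>near R - {0}. sigma_factor \<omega> z)"

lemma log_tail_deriv:
  assumes "norm z < R"
  obtains g where "(log_tail R has_field_derivative g) (at z)"
    "((\<lambda>\<omega>. zeta_summand \<omega> z) has_sum g) (far R)"
proof (rule has_sum_termwise_derivative)
  show "open (ball 0 R)" "z \<in> ball 0 R" using assms by auto
  show "((\<lambda>z. Ln (sigma_factor \<omega> z)) has_field_derivative zeta_summand \<omega> w) (at w)"
    and "norm (Ln (sigma_factor \<omega> w)) \<le> 6 * R ^ 3 * (1 / norm \<omega> ^ 3)"
    if "\<omega> \<in> far R" "w \<in> ball 0 R" for \<omega> w
    using that by (auto intro!: Ln_sigma_factor(1,2) simp del: times_divide_eq_right)
  show "(\<lambda>\<omega>. 6 * R ^ 3 * (1 / norm \<omega> ^ 3)) summable_on far R" by (rule summable_on_far)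
qed (use that in \<open>simp add: log_tail_def[abs_def]\<close>)

text \<open>This evaluates the unordered limit in the definition of sigma: a large finite set F
  contains the near lattice points, so its product is the fixed near product times the exponential
  of a partial sum of logarithms.\<close>

lemma weierstrass_sigma_eq:
  assumes "norm z < R"
  shows "weierstrass_sigma \<Omega> z = z * near_product R z * exp (log_tail R z)"
proof -
  have R: "R > 0" using assms(1) norm_ge_zero[of z] by linarith
  \<comment> \<open>Extension by 0 makes the tail a sum over the index set of the product, so that
    both limits use the same filter.\<close>
  define f where "f = (\<lambda>\<omega>. if \<omega> \<in> far R then Ln (sigma_factor \<omega> z) else 0)"
  have "(\<lambda>\<omega>. Ln (sigma_factor \<omega> z)) summable_on far R"
  proof (rule abs_summable_summable, rule Infinite_Sum.abs_summable_on_comparison_test')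
    show "(\<lambda>\<omega>. 6 * R ^ 3 * (1 / norm \<omega> ^ 3)) summable_on far R" by (rule summable_on_far)
  qed (rule Ln_sigma_factor(1)[OF assms])
  then have "((\<lambda>\<omega>. Ln (sigma_factor \<omega> z)) has_sum log_tail R z) (far R)"
    unfolding log_tail_def by (rule has_sum_infsum)
  also have "?this \<longleftrightarrow> (f has_sum log_tail R z) (\<Omega> - {0})"
    using R by (intro has_sum_cong_neutral) (auto simp: f_def far_def)
  finally have "((\<lambda>F. near_product R z * exp (\<Sum>\<omega>\<in>F. f \<omega>)) \<longlongrightarrow> near_product R z * exp (log_tail R z))
      (finite_subsets_at_top (\<Omega> - {0}))"
    unfolding has_sum_def by (intro tendsto_intros)
  moreover have "\<forall>\<^sub>F F in finite_subsets_at_top (\<Omega> - {0}).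
      near_product R z * exp (\<Sum>\<omega>\<in>F. f \<omega>) = (\<Prod>\<omega>\<in>F. sigma_factor \<omega> z)"
  proof -
    have "\<forall>\<^sub>F F in finite_subsets_at_top (\<Omega> - {0}). finite F \<and> near R - {0} \<subseteq> F \<and> F \<subseteq> \<Omega> - {0}"
      unfolding eventually_finite_subsets_at_top
      using finite_near[of R] near_Un_far[of R] by (intro exI[of _ "near R - {0}"]) auto
    then show ?thesis
    proof eventually_elim
      case (elim F)
      have F: "F = (near R - {0}) \<union> (F \<inter> far R)" "(near R - {0}) \<inter> (F \<inter> far R) = {}"
        using elim near_Un_far near_Int_far by blast+
      have "(\<Prod>\<omega>\<in>F. sigma_factor \<omega> z) = near_product R z * (\<Prod>\<omega>\<in>F \<inter> far R. sigma_factor \<omega> z)"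
        unfolding near_product_def using F elim finite_near
        by (subst F(1), subst prod.union_disjoint) auto
      also have "(\<Prod>\<omega>\<in>F \<inter> far R. sigma_factor \<omega> z) = (\<Prod>\<omega>\<in>F \<inter> far R. exp (Ln (sigma_factor \<omega> z)))"
        using Ln_sigma_factor(3)[OF assms] by (intro prod.cong) auto
      also have "\<dots> = exp (\<Sum>\<omega>\<in>F. f \<omega>)"
        using elim by (simp add: f_def exp_sum sum.If_cases flip: sum.inter_restrict)
      finally show ?case by simp
    qed
  qed
  ultimately have "((\<lambda>F. \<Prod>\<omega>\<in>F. sigma_factor \<omega> z) \<longlongrightarrow> near_product R z * exp (log_tail R z))
      (finite_subsets_at_top (\<Omega> - {0}))"
    by (rule Lim_transform_eventually)
  then have "Lim (finite_subsets_at_top (\<Omega> - {0})) (\<lambda>F. \<Prod>\<omega>\<in>F. sigma_factor \<omega> z) =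
      near_product R z * exp (log_tail R z)"
    by (intro tendsto_Lim) auto
  then show ?thesis by (simp add: weierstrass_sigma_def sigma_factor_def)
qed

lemma weierstrass_sigma_eq_0_iff: "weierstrass_sigma \<Omega> z = 0 \<longleftrightarrow> z \<in> \<Omega>"
proof -
  define R where "R = norm z + 1"
  have "weierstrass_sigma \<Omega> z = 0 \<longleftrightarrow> z = 0 \<or> (\<exists>\<omega>\<in>near R - {0}. z = \<omega>)"
    using finite_near[of R] by (auto simp: weierstrass_sigma_eq[of z R] R_def near_product_def sigma_factor_eq_0_iff)
  also have "\<dots> \<longleftrightarrow> z \<in> \<Omega>"
    using zero_mem by (auto simp: near_def R_def intro: add_nonneg_pos)
  finally show ?thesis .
qed

lemma holomorphic_weierstrass_sigma: "weierstrass_sigma \<Omega> holomorphic_on UNIV"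
proof -
  have "weierstrass_sigma \<Omega> field_differentiable (at z)" for z
  proof -
    define R where "R = norm z + 1"
    obtain g where g: "(log_tail R has_field_derivative g) (at z)"
      by (rule log_tail_deriv[of z R]) (auto simp: R_def)
    have "(\<lambda>z. z * near_product R z) holomorphic_on UNIV"
      unfolding near_product_def sigma_factor_def by (intro holomorphic_intros) auto
    then have "(\<lambda>z. z * near_product R z) field_differentiable (at z)"
      by (rule holomorphic_on_imp_differentiable_at) auto
    moreover have "(\<lambda>z. exp (log_tail R z)) field_differentiable (at z)"
      using DERIV_chain2[OF DERIV_exp g] by (auto simp: field_differentiable_def)
    ultimately have "(\<lambda>z. z * near_product R z * exp (log_tail R z)) field_differentiable (at z)"
      by (rule field_differentiable_mult)
    then obtain g' where "((\<lambda>z. z * near_product R z * exp (log_tail R z)) has_field_derivative g') (at z)"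
      by (auto simp: field_differentiable_def)
    then have "(weierstrass_sigma \<Omega> has_field_derivative g') (at z)"
      by (rule has_field_derivative_transform_within_open[of _ _ _ "ball 0 R"])
         (auto simp: R_def weierstrass_sigma_eq)
    then show ?thesis by (auto simp: field_differentiable_def)
  qed
  then show ?thesis by (simp add: holomorphic_on_def)
qed

text \<open>The lattice is closed as the zero set of the continuous function sigma.\<close>

lemma open_compl_lattice: "open (- \<Omega>)"
proof -
  have "closed (weierstrass_sigma \<Omega> -` {0})"
    using holomorphic_on_imp_continuous_on[OF holomorphic_weierstrass_sigma]
    by (intro closed_vimage) auto
  also have "weierstrass_sigma \<Omega> -` {0} = \<Omega>" by (auto simp: weierstrass_sigma_eq_0_iff)
  finally show ?thesis by (simp add: open_Compl)
qed

lemma connected_compl_lattice: "connected (- \<Omega>)"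
  using path_connected_complement_countable[OF _ countable_lattice]
  by (simp add: path_connected_imp_connected)

text \<open>Logarithmic derivative of \<open>weierstrass_sigma_eq\<close>. The leading factor z
  contributes 1 / z, which is the summand at \<omega> = 0, so the finite sum runs over all of
  \<open>near R\<close>.\<close>

lemma weierstrass_zeta_eq:
  assumes "norm z < R" "z \<notin> \<Omega>"
  shows "weierstrass_zeta \<Omega> z = (\<Sum>\<omega>\<in>near R. zeta_summand \<omega> z) + (\<Sum>\<^sub>\<infinity>\<omega>\<in>far R. zeta_summand \<omega> z)"
proof -
  have R: "R > 0" using assms(1) norm_ge_zero[of z] by linarith
  obtain g where g: "(log_tail R has_field_derivative g) (at z)"
    "((\<lambda>\<omega>. zeta_summand \<omega> z) has_sum g) (far R)"
    by (rule log_tail_deriv[OF assms(1)])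
  have nz: "sigma_factor \<omega> z \<noteq> 0" "z \<noteq> \<omega>" if "\<omega> \<in> near R - {0}" for \<omega>
    using that assms by (auto simp: sigma_factor_eq_0_iff near_def)
  have z: "z \<noteq> 0" using assms zero_mem by auto
  have "(near_product R has_field_derivative near_product R z *
      (\<Sum>\<omega>\<in>near R - {0}. sigma_factor \<omega> z * zeta_summand \<omega> z / sigma_factor \<omega> z)) (at z)"
    unfolding near_product_def[abs_def] using nz
    by (intro has_field_derivative_prod' has_field_derivative_sigma_factor) auto
  also have "(\<Sum>\<omega>\<in>near R - {0}. sigma_factor \<omega> z * zeta_summand \<omega> z / sigma_factor \<omega> z) =
      (\<Sum>\<omega>\<in>near R - {0}. zeta_summand \<omega> z)"
    using nz by (intro sum.cong) auto
  finally have P: "(near_product R has_field_derivative near_product R z * (\<Sum>\<omega>\<in>near R - {0}. zeta_summand \<omega> z)) (at z)" .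
  have "((\<lambda>z. z * near_product R z * exp (log_tail R z)) has_field_derivative
      z * near_product R z * exp (log_tail R z) * (1 / z + (\<Sum>\<omega>\<in>near R - {0}. zeta_summand \<omega> z) + g)) (at z)"
    by (rule derivative_eq_intros P DERIV_exp g refl)+ (use z in \<open>simp add: field_simps\<close>)
  then have "(weierstrass_sigma \<Omega> has_field_derivative
      z * near_product R z * exp (log_tail R z) * (1 / z + (\<Sum>\<omega>\<in>near R - {0}. zeta_summand \<omega> z) + g)) (at z)"
    by (rule has_field_derivative_transform_within_open[of _ _ _ "ball 0 R"])
       (use assms in \<open>auto simp: weierstrass_sigma_eq\<close>)
  then have "(weierstrass_sigma \<Omega> has_field_derivative
      weierstrass_sigma \<Omega> z * (1 / z + (\<Sum>\<omega>\<in>near R - {0}. zeta_summand \<omega> z) + g)) (at z)"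
    by (simp only: weierstrass_sigma_eq[OF assms(1)])
  then have "weierstrass_zeta \<Omega> z = 1 / z + (\<Sum>\<omega>\<in>near R - {0}. zeta_summand \<omega> z) + g"
    using assms(2) by (simp add: weierstrass_zeta_def DERIV_imp_deriv weierstrass_sigma_eq_0_iff)
  also have "1 / z = zeta_summand 0 z" by (simp add: zeta_summand_def)
  also have "zeta_summand 0 z + (\<Sum>\<omega>\<in>near R - {0}. zeta_summand \<omega> z) = (\<Sum>\<omega>\<in>near R. zeta_summand \<omega> z)"
    using finite_near[of R] zero_mem R by (intro sum.remove[symmetric]) (auto simp: near_def)
  also have "g = (\<Sum>\<^sub>\<infinity>\<omega>\<in>far R. zeta_summand \<omega> z)" using g(2) by (simp add: infsumI)
  finally show ?thesis .
qed

lemma weierstrass_zeta_deriv_and_p_sum: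
  assumes "z \<notin> \<Omega>"
  shows has_field_derivative_weierstrass_zeta:
      "(weierstrass_zeta \<Omega> has_field_derivative - weierstrass_p \<Omega> z) (at z)"
    and weierstrass_p_has_sum: "((\<lambda>\<omega>. p_summand \<omega> z) has_sum weierstrass_p \<Omega> z) \<Omega>"
proof -
  define R where "R = norm z + 1"
  have R: "norm z < R" "R > 0" by (auto simp: R_def add_nonneg_pos)
  obtain g where g: "((\<lambda>z. \<Sum>\<^sub>\<infinity>\<omega>\<in>far R. zeta_summand \<omega> z) has_field_derivative g) (at z)"
    "((\<lambda>\<omega>. - p_summand \<omega> z) has_sum g) (far R)"
  proof (rule has_sum_termwise_derivative)
    show "open (ball 0 R)" "z \<in> ball 0 R" using R by auto
    show "(zeta_summand \<omega> has_field_derivative - p_summand \<omega> w) (at w)" if "\<omega> \<in> far R" "w \<in> ball 0 R" for \<omega> w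
      using that R by (intro has_field_derivative_zeta_summand) (auto simp: far_def)
    show "norm (zeta_summand \<omega> w) \<le> 2 * R ^ 2 * (1 / norm \<omega> ^ 3)" if "\<omega> \<in> far R" "w \<in> ball 0 R" for \<omega> w
      using that by (intro norm_zeta_summand) (auto simp: far_def)
    show "(\<lambda>\<omega>. 2 * R ^ 2 * (1 / norm \<omega> ^ 3)) summable_on far R" by (rule summable_on_far)
  qed
  have "((\<lambda>z. (\<Sum>\<omega>\<in>near R. zeta_summand \<omega> z) + (\<Sum>\<^sub>\<infinity>\<omega>\<in>far R. zeta_summand \<omega> z)) has_field_derivative
      (\<Sum>\<omega>\<in>near R. - p_summand \<omega> z) + g) (at z)"
    using assms by (intro DERIV_add DERIV_sum g has_field_derivative_zeta_summand) (auto simp: near_def)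
  \<comment> \<open>The expansion of zeta holds only off the lattice, so the comparison takes place
    on the ball without the lattice points.\<close>
  then have *: "(weierstrass_zeta \<Omega> has_field_derivative (\<Sum>\<omega>\<in>near R. - p_summand \<omega> z) + g) (at z)"
    by (rule has_field_derivative_transform_within_open[of _ _ _ "ball 0 R \<inter> - \<Omega>"])
       (use assms R in \<open>auto simp: weierstrass_zeta_eq open_compl_lattice\<close>)
  then have p: "- weierstrass_p \<Omega> z = (\<Sum>\<omega>\<in>near R. - p_summand \<omega> z) + g"
    by (simp add: weierstrass_p_def DERIV_imp_deriv)
  with * show "(weierstrass_zeta \<Omega> has_field_derivative - weierstrass_p \<Omega> z) (at z)" by simp
  have "((\<lambda>\<omega>. - p_summand \<omega> z) has_sum ((\<Sum>\<omega>\<in>near R. - p_summand \<omega> z) + g)) (near R \<union> far R)"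
    using finite_near g(2) near_Int_far by (intro has_sum_Un_disjoint) auto
  then show "((\<lambda>\<omega>. p_summand \<omega> z) has_sum weierstrass_p \<Omega> z) \<Omega>"
    unfolding near_Un_far p[symmetric] by (simp add: has_sum_uminus)
qed

section \<open>Periodicity of p and quasi-periodicity of zeta\<close>

lemma weierstrass_p_even:
  assumes "z \<notin> \<Omega>"
  shows "weierstrass_p \<Omega> (- z) = weierstrass_p \<Omega> z"
proof -
  have "((\<lambda>\<omega>. p_summand \<omega> (- z)) has_sum weierstrass_p \<Omega> z) \<Omega>"
    using weierstrass_p_has_sum[OF assms]
    by (subst has_sum_reindex_bij_witness[of \<Omega> uminus uminus \<Omega> "\<lambda>\<omega>. p_summand \<omega> z"])
       (auto simp: minus_mem p_summand_def power2_eq_square algebra_simps)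
  moreover have "((\<lambda>\<omega>. p_summand \<omega> (- z)) has_sum weierstrass_p \<Omega> (- z)) \<Omega>"
    using assms by (intro weierstrass_p_has_sum) (simp add: minus_mem_iff)
  ultimately show ?thesis using has_sum_unique by blast
qed

text \<open>After reindexing the shifted series by \<omega> + a, the termwise difference is free of
  z, so p(z + a) - p(z) is a constant K. Using this at -(z + a) and evenness gives K = -K.\<close>

lemma weierstrass_p_periodic:
  assumes a: "a \<in> \<Omega>" and "z \<notin> \<Omega>"
  shows "weierstrass_p \<Omega> (z + a) = weierstrass_p \<Omega> z"
proof -
  define K where "K = (\<Sum>\<^sub>\<infinity>\<omega>\<in>\<Omega>. 1 / \<omega>\<^sup>2 - 1 / (\<omega> + a)\<^sup>2)"
  have *: "weierstrass_p \<Omega> (z + a) - weierstrass_p \<Omega> z = K" if z: "z \<notin> \<Omega>" for z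
  proof -
    have "((\<lambda>\<omega>. p_summand \<omega> (z + a)) has_sum weierstrass_p \<Omega> (z + a)) \<Omega>"
      using z a by (intro weierstrass_p_has_sum) (simp add: add_mem_iff)
    then have "((\<lambda>\<omega>. p_summand (\<omega> + a) (z + a)) has_sum weierstrass_p \<Omega> (z + a)) \<Omega>"
      by (subst has_sum_reindex_bij_witness[of \<Omega> "\<lambda>\<omega>. \<omega> - a" "\<lambda>\<omega>. \<omega> + a" \<Omega> "\<lambda>\<omega>. p_summand \<omega> (z + a)"])
         (auto simp: add_mem diff_mem a)
    from has_sum_add[OF this has_sum_uminusI[OF weierstrass_p_has_sum[OF z]]]
    have "((\<lambda>\<omega>. 1 / \<omega>\<^sup>2 - 1 / (\<omega> + a)\<^sup>2) has_sum weierstrass_p \<Omega> (z + a) - weierstrass_p \<Omega> z) \<Omega>"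
      by (simp add: p_summand_def)
    then show ?thesis by (simp add: K_def infsumI)
  qed
  have z': "z + a \<notin> \<Omega>" using assms by (simp add: add_mem_iff)
  then have "- (z + a) \<notin> \<Omega>" by (simp only: minus_mem_iff not_False_eq_True)
  from *[OF this] have "weierstrass_p \<Omega> (- z) - weierstrass_p \<Omega> (- (z + a)) = K" by simp
  then have "weierstrass_p \<Omega> z - weierstrass_p \<Omega> (z + a) = K"
    using weierstrass_p_even[OF assms(2)] weierstrass_p_even[OF z'] by simp
  with *[OF assms(2)] have "K = 0" by (simp add: algebra_simps eq_neg_iff_add_eq_0)
  with *[OF assms(2)] show ?thesis by simp
qed

text \<open>The difference has derivative 0 by periodicity of p, and the complement of the countable
  lattice is connected.\<close>

lemma weierstrass_zeta_quasi_periodic: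
  assumes "a \<in> \<Omega>"
  obtains \<eta> where "\<And>z. z \<notin> \<Omega> \<Longrightarrow> weierstrass_zeta \<Omega> (z + a) = weierstrass_zeta \<Omega> z + \<eta>"
proof -
  define f where "f = (\<lambda>z. weierstrass_zeta \<Omega> (z + a) - weierstrass_zeta \<Omega> z)"
  have "(f has_field_derivative 0) (at z)" if "z \<in> - \<Omega>" for z
  proof -
    have "((\<lambda>z. weierstrass_zeta \<Omega> (z + a)) has_field_derivative - weierstrass_p \<Omega> (z + a)) (at z)"
      using that assms by (subst DERIV_shift[symmetric]) (simp add: has_field_derivative_weierstrass_zeta add_mem_iff)
    from DERIV_diff[OF this has_field_derivative_weierstrass_zeta[of z]] show ?thesis
      using that by (simp add: f_def weierstrass_p_periodic[OF assms])
  qed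
  then have "f constant_on - \<Omega>"
    using connected_compl_lattice open_compl_lattice by (rule has_field_derivative_0_imp_constant_on)
  then obtain \<eta> where "\<And>z. z \<in> - \<Omega> \<Longrightarrow> f z = \<eta>" unfolding constant_on_def by blast
  then show ?thesis by (intro that[of \<eta>]) (auto simp: f_def algebra_simps)
qed

end

section \<open>Independence of the quasi-periods\<close>

lemma periodic_of_int:
  fixes f :: "complex \<Rightarrow> 'a"
  assumes "\<And>z. f (z + a) = f z"
  shows "f (z + of_int m * a) = f z"
proof (induction m rule: int_induct[where k = 0])
  case base
  show ?case by simp
next
  case (step1 i)
  then show ?case using assms[of "z + of_int i * a"] by (simp add: algebra_simps)
next
  case (step2 i)
  then show ?case using assms[of "z + of_int (i - 1) * a"] by (simp add: algebra_simps)
qed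

context lattice_basis
begin

text \<open>Cramer's rule. The identities are kept multiplied by D, so that only polynomial
  identities have to be checked.\<close>

lemma real_coordinates:
  obtains s t where "z = of_real s * \<omega>1 + of_real t * \<omega>2"
proof -
  define D where "D = Im (\<omega>1 * cnj \<omega>2)"
  have D: "D \<noteq> 0" "D = Im \<omega>1 * Re \<omega>2 - Re \<omega>1 * Im \<omega>2"
    using Im_nonzero by (auto simp: D_def)
  define s t where "s = (Im z * Re \<omega>2 - Re z * Im \<omega>2) / D" and "t = (Im \<omega>1 * Re z - Re \<omega>1 * Im z) / D"
  have sD: "s * D = Im z * Re \<omega>2 - Re z * Im \<omega>2" and tD: "t * D = Im \<omega>1 * Re z - Re \<omega>1 * Im z"
    using D(1) by (simp_all add: s_def t_def)
  have "D * Re z = (s * D) * Re \<omega>1 + (t * D) * Re \<omega>2"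
    unfolding sD tD unfolding D(2) by algebra
  then have "D * Re z = D * (s * Re \<omega>1 + t * Re \<omega>2)" by (simp add: algebra_simps)
  moreover have "D * Im z = (s * D) * Im \<omega>1 + (t * D) * Im \<omega>2"
    unfolding sD tD unfolding D(2) by algebra
  then have "D * Im z = D * (s * Im \<omega>1 + t * Im \<omega>2)" by (simp add: algebra_simps)
  ultimately show ?thesis using D(1) by (intro that[of s t]) (simp add: complex_eq_iff)
qed

text \<open>The maps z -> Re (\<alpha> z) are all the real-linear functionals on the plane, so their
  values on a real basis can be prescribed.\<close>

lemma prescribed_real_parts:
  obtains \<alpha> where "Re (\<alpha> * \<omega>1) = r1" "Re (\<alpha> * \<omega>2) = r2"
proof -
  define D where "D = Im (\<omega>1 * cnj \<omega>2)"
  have D: "D \<noteq> 0" "D = Im \<omega>1 * Re \<omega>2 - Re \<omega>1 * Im \<omega>2"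
    using Im_nonzero by (auto simp: D_def)
  define x y where "x = (r2 * Im \<omega>1 - r1 * Im \<omega>2) / D" and "y = (r2 * Re \<omega>1 - r1 * Re \<omega>2) / D"
  have xD: "x * D = r2 * Im \<omega>1 - r1 * Im \<omega>2" and yD: "y * D = r2 * Re \<omega>1 - r1 * Re \<omega>2"
    using D(1) by (simp_all add: x_def y_def)
  have "(x * D) * Re \<omega>1 - (y * D) * Im \<omega>1 = r1 * D" "(x * D) * Re \<omega>2 - (y * D) * Im \<omega>2 = r2 * D"
    unfolding xD yD unfolding D(2) by algebra+
  then have "(x * Re \<omega>1 - y * Im \<omega>1) * D = r1 * D" "(x * Re \<omega>2 - y * Im \<omega>2) * D = r2 * D"
    by (simp_all add: algebra_simps)
  then show ?thesis using D(1) by (intro that[of "Complex x y"]) simp_all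
qed

lemma not_mem_lattice_ex:
  obtains z where "z \<notin> \<Omega>"
  using countable_lattice uncountable_UNIV_complex by (metis UNIV_eq_I)

text \<open>A qualitative form of Legendre's relation, which says that this determinant is 2 \<pi> i
  up to sign; Liouville's theorem takes the place of a contour integral.\<close>

lemma quasi_periods_independent:
  assumes \<eta>1: "\<And>z. z \<notin> \<Omega> \<Longrightarrow> weierstrass_zeta \<Omega> (z + \<omega>1) = weierstrass_zeta \<Omega> z + \<eta>1"
    and \<eta>2: "\<And>z. z \<notin> \<Omega> \<Longrightarrow> weierstrass_zeta \<Omega> (z + \<omega>2) = weierstrass_zeta \<Omega> z + \<eta>2"
  shows "\<omega>1 * \<eta>2 - \<omega>2 * \<eta>1 \<noteq> 0"
proof
  assume eq: "\<omega>1 * \<eta>2 - \<omega>2 * \<eta>1 = 0"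
  define c where "c = \<eta>1 / \<omega>1"
  have "\<omega>1 \<noteq> 0" using Im_nonzero by auto
  then have c: "\<eta>1 = c * \<omega>1" "\<eta>2 = c * \<omega>2" using eq by (simp_all add: c_def field_simps)
  \<comment> \<open>The Gaussian factor makes the logarithmic derivative zeta(z) - c z, which is
    periodic because both quasi-periods are c times the periods.\<close>
  define g where "g = (\<lambda>z. weierstrass_sigma \<Omega> z * exp (- (c * z\<^sup>2 / 2)))"
  have g0: "g z = 0 \<longleftrightarrow> z \<in> \<Omega>" for z by (simp add: g_def weierstrass_sigma_eq_0_iff)
  have g_holo: "g holomorphic_on UNIV"
    unfolding g_def by (intro holomorphic_intros holomorphic_weierstrass_sigma) auto
  have g': "(g has_field_derivative g z * (weierstrass_zeta \<Omega> z - c * z)) (at z)" if "z \<notin> \<Omega>" for z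
  proof -
    have "(weierstrass_sigma \<Omega> has_field_derivative deriv (weierstrass_sigma \<Omega>) z) (at z)"
      using holomorphic_derivI[OF holomorphic_weierstrass_sigma] by auto
    also have "deriv (weierstrass_sigma \<Omega>) z = weierstrass_sigma \<Omega> z * weierstrass_zeta \<Omega> z"
      using that by (simp add: weierstrass_zeta_def weierstrass_sigma_eq_0_iff)
    finally have s: "(weierstrass_sigma \<Omega> has_field_derivative weierstrass_sigma \<Omega> z * weierstrass_zeta \<Omega> z) (at z)" .
    have "((\<lambda>z. - (c * z\<^sup>2 / 2)) has_field_derivative - (c * z)) (at z)"
      by (auto intro!: derivative_eq_intros)
    from DERIV_mult[OF s DERIV_chain2[OF DERIV_exp this]] show ?thesis
      unfolding g_def by (rule DERIV_cong) (simp add: algebra_simps)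
  qed
  obtain z0 where z0: "z0 \<notin> \<Omega>" by (rule not_mem_lattice_ex)
  \<comment> \<open>The quotient g(z + a) / g(z) has derivative 0 off the lattice because g'/g has
    period a. At lattice points both sides of the multiplier rule vanish.\<close>
  have mult: "\<exists>\<mu>. \<mu> \<noteq> 0 \<and> (\<forall>z. g (z + a) = \<mu> * g z)"
    if a: "a \<in> \<Omega>" and zeta: "\<And>z. z \<notin> \<Omega> \<Longrightarrow> weierstrass_zeta \<Omega> (z + a) = weierstrass_zeta \<Omega> z + c * a" for a
  proof -
    have "((\<lambda>z. g (z + a) / g z) has_field_derivative 0) (at z)" if "z \<in> - \<Omega>" for z
    proof -
      have z: "z \<notin> \<Omega>" "z + a \<notin> \<Omega>" using that a by (auto simp: add_mem_iff)
      have "((\<lambda>z. g (z + a)) has_field_derivative g (z + a) * (weierstrass_zeta \<Omega> (z + a) - c * (z + a))) (at z)"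
        using g'[OF z(2)] by (simp only: DERIV_shift)
      from DERIV_divide[OF this g'[OF z(1)]] show ?thesis
        unfolding zeta[OF z(1)] using z by (auto elim!: DERIV_cong simp: g0 algebra_simps)
    qed
    then have "(\<lambda>z. g (z + a) / g z) constant_on - \<Omega>"
      using connected_compl_lattice open_compl_lattice by (rule has_field_derivative_0_imp_constant_on)
    then obtain \<mu> where \<mu>: "\<And>z. z \<notin> \<Omega> \<Longrightarrow> g (z + a) / g z = \<mu>" unfolding constant_on_def by auto
    have "g (z + a) = \<mu> * g z" for z
    proof (cases "z \<in> \<Omega>")
      case True
      then have "g (z + a) = 0" "g z = 0" using a by (simp_all add: g0 add_mem_iff)
      then show ?thesis by simp
    next
      case False
      then show ?thesis using \<mu>[of z] by (simp add: g0 field_simps)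
    qed
    moreover have "\<mu> \<noteq> 0"
      using \<mu>[OF z0] z0 a by (auto simp: g0 add_mem_iff)
    ultimately show ?thesis by blast
  qed
  obtain \<mu>1 where \<mu>1: "\<mu>1 \<noteq> 0" "\<And>z. g (z + \<omega>1) = \<mu>1 * g z"
    using mult[OF basis_mem(1)] \<eta>1 c by auto
  obtain \<mu>2 where \<mu>2: "\<mu>2 \<noteq> 0" "\<And>z. g (z + \<omega>2) = \<mu>2 * g z"
    using mult[OF basis_mem(2)] \<eta>2 c by auto
  \<comment> \<open>Chosen so that exp (\<alpha> z) changes in modulus by 1 / |\<mu>| under each
    basis translation, which cancels the multiplier.\<close>
  obtain \<alpha> where \<alpha>: "Re (\<alpha> * \<omega>1) = - ln (norm \<mu>1)" "Re (\<alpha> * \<omega>2) = - ln (norm \<mu>2)"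
    by (rule prescribed_real_parts)
  define h where "h = (\<lambda>z. g z * exp (\<alpha> * z))"
  have h_holo: "h holomorphic_on UNIV" unfolding h_def by (intro holomorphic_intros g_holo)
  have per: "norm (h (z + a)) = norm (h z)"
    if "g (z + a) = \<mu> * g z" "\<mu> \<noteq> 0" "Re (\<alpha> * a) = - ln (norm \<mu>)" for a \<mu> z
  proof -
    have "norm (exp (\<alpha> * (z + a))) = exp (Re (\<alpha> * z)) * exp (Re (\<alpha> * a))"
      by (simp add: distrib_left exp_add norm_mult del: times_complex.sel)
    also have "\<dots> = norm (exp (\<alpha> * z)) / norm \<mu>"
      using that(2) by (simp only: that(3)) (simp add: exp_minus divide_inverse)
    finally show ?thesis using that by (simp add: h_def norm_mult)
  qed
  \<comment> \<open>The closed period parallelogram: a bound for h there holds on the whole plane by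
    periodicity of the modulus.\<close>
  define K where "K = (\<lambda>(s, t). complex_of_real s * \<omega>1 + of_real t * \<omega>2) ` ({0..1} \<times> {0..1})"
  have "compact K"
    unfolding K_def case_prod_unfold
    by (intro compact_continuous_image compact_Times continuous_intros) auto
  then have "compact (h ` K)"
    using h_holo by (intro compact_continuous_image) (auto intro: continuous_on_subset holomorphic_on_imp_continuous_on)
  then obtain B where B: "\<And>z. z \<in> K \<Longrightarrow> norm (h z) \<le> B"
    using compact_imp_bounded bounded_iff by (metis imageI)
  have "norm (h z) \<le> B" for z
  proof -
    obtain s t where z: "z = of_real s * \<omega>1 + of_real t * \<omega>2" by (rule real_coordinates)
    define w where "w = of_real (frac s) * \<omega>1 + of_real (frac t) * \<omega>2"
    have "z = w + of_int \<lfloor>s\<rfloor> * \<omega>1 + of_int \<lfloor>t\<rfloor> * \<omega>2"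
      by (simp add: z w_def frac_def algebra_simps)
    then have "norm (h z) = norm (h w)"
      using periodic_of_int[of "\<lambda>z. norm (h z)" \<omega>1 w "\<lfloor>s\<rfloor>"]
        periodic_of_int[of "\<lambda>z. norm (h z)" \<omega>2 "w + of_int \<lfloor>s\<rfloor> * \<omega>1" "\<lfloor>t\<rfloor>"]
        per[OF \<mu>1(2,1) \<alpha>(1)] per[OF \<mu>2(2,1) \<alpha>(2)] by simp
    also have "\<dots> \<le> B"
      unfolding w_def K_def
      by (intro B) (auto simp: K_def frac_lt_1 less_imp_le intro!: image_eqI[of _ _ "(frac s, frac t)"])
    finally show ?thesis .
  qed
  then have "bounded (range h)" unfolding bounded_iff by blast
  then have "h constant_on UNIV" by (rule Liouville_theorem[OF h_holo])
  then have "h z0 = h 0" unfolding constant_on_def by force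
  then show False using z0 zero_mem g0[of 0] g0[of z0] by (simp add: h_def)
qed

section \<open>The values of p\<close>

lemma holomorphic_weierstrass_p: "weierstrass_p \<Omega> holomorphic_on - \<Omega>"
proof -
  have "weierstrass_zeta \<Omega> holomorphic_on - \<Omega>"
    unfolding holomorphic_on_open[OF open_compl_lattice]
    using has_field_derivative_weierstrass_zeta by blast
  then have "(\<lambda>z. - deriv (weierstrass_zeta \<Omega>) z) holomorphic_on - \<Omega>"
    by (intro holomorphic_intros holomorphic_deriv open_compl_lattice)
  then show ?thesis by (simp add: weierstrass_p_def[abs_def])
qed

text \<open>A constant p would make zeta affine, hence its quasi-periods proportional to the
  periods, against their independence.\<close>

lemma weierstrass_p_nonconstant: "\<not> weierstrass_p \<Omega> constant_on - \<Omega>"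
proof
  assume "weierstrass_p \<Omega> constant_on - \<Omega>"
  then obtain p where p: "\<And>z. z \<notin> \<Omega> \<Longrightarrow> weierstrass_p \<Omega> z = p" unfolding constant_on_def by auto
  have "((\<lambda>z. weierstrass_zeta \<Omega> z + p * z) has_field_derivative 0) (at z)" if "z \<in> - \<Omega>" for z
    using DERIV_add[OF has_field_derivative_weierstrass_zeta[of z] DERIV_cmult[OF DERIV_ident, where c = p]] that p by simp
  then have "(\<lambda>z. weierstrass_zeta \<Omega> z + p * z) constant_on - \<Omega>"
    using connected_compl_lattice open_compl_lattice by (rule has_field_derivative_0_imp_constant_on)
  then obtain d where "\<And>z. z \<notin> \<Omega> \<Longrightarrow> weierstrass_zeta \<Omega> z + p * z = d" unfolding constant_on_def by auto
  then have d: "weierstrass_zeta \<Omega> z = d - p * z" if "z \<notin> \<Omega>" for z using that by (simp add: eq_diff_eq)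
  have *: "weierstrass_zeta \<Omega> (z + a) = weierstrass_zeta \<Omega> z + (- p * a)" if "z \<notin> \<Omega>" "a \<in> \<Omega>" for z a
  proof -
    have "z + a \<notin> \<Omega>" using that by (simp add: add_mem_iff)
    then show ?thesis unfolding d[OF that(1)] by (simp add: d algebra_simps)
  qed
  show False using quasi_periods_independent[OF *[OF _ basis_mem(1)] *[OF _ basis_mem(2)]] by simp
qed

text \<open>The level sets of the nonconstant holomorphic p are countable. With finitely many
  values, the plane would be a countable union of countable sets.\<close>

lemma infinite_weierstrass_p_values:
  assumes "countable N"
  shows "infinite (weierstrass_p \<Omega> ` (- \<Omega> - N))"
proof
  assume fin: "finite (weierstrass_p \<Omega> ` (- \<Omega> - N))"
  have "countable {z \<in> - \<Omega>. weierstrass_p \<Omega> z = v}" for v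
  proof -
    obtain F :: "nat \<Rightarrow> complex set" where "\<And>n. compact (F n)" "\<Union> (range F) = - \<Omega>"
      using open_Union_compact_subsets[OF open_compl_lattice] by metis
    then have "fsigma (- \<Omega>)" unfolding fsigma_Union_compact by blast
    moreover have "\<not> (\<lambda>z. weierstrass_p \<Omega> z - v) constant_on - \<Omega>"
      using weierstrass_p_nonconstant unfolding constant_on_def by (metis diff_add_cancel)
    ultimately have "countable {z \<in> - \<Omega>. weierstrass_p \<Omega> z - v = 0}"
      by (intro holomorphic_countable_zeros open_compl_lattice connected_compl_lattice
          holomorphic_intros holomorphic_weierstrass_p)
    then show ?thesis by simp
  qed
  then have "countable (\<Union>v\<in>weierstrass_p \<Omega> ` (- \<Omega> - N). {z \<in> - \<Omega>. weierstrass_p \<Omega> z = v})"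
    using fin by (intro countable_UN) (auto simp: countable_finite)
  then have "countable (\<Omega> \<union> N \<union> (\<Union>v\<in>weierstrass_p \<Omega> ` (- \<Omega> - N). {z \<in> - \<Omega>. weierstrass_p \<Omega> z = v}))"
    using countable_lattice assms by blast
  moreover have "\<Omega> \<union> N \<union> (\<Union>v\<in>weierstrass_p \<Omega> ` (- \<Omega> - N). {z \<in> - \<Omega>. weierstrass_p \<Omega> z = v}) = UNIV"
    by auto
  ultimately show False using uncountable_UNIV_complex by (simp only: simp_thms)
qed

lemma weierstrass_zeta_add_of_nat_mult:
  assumes "a \<in> \<Omega>" "\<And>z. z \<notin> \<Omega> \<Longrightarrow> weierstrass_zeta \<Omega> (z + a) = weierstrass_zeta \<Omega> z + \<eta>" "z \<notin> \<Omega>"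
  shows "weierstrass_zeta \<Omega> (z + of_nat k * a) = weierstrass_zeta \<Omega> z + of_nat k * \<eta>"
proof (induction k)
  case (Suc k)
  have "z + of_nat k * a \<notin> \<Omega>" using assms by (simp add: add_mem_iff of_nat_mult_mem)
  from assms(2)[OF this] Suc show ?case by (simp add: algebra_simps)
qed simp

section \<open>Algebraic independence\<close>

lemma no_algebraic_relation:
  assumes "Re \<omega>1 > 0" "countable N"
    and rel: "\<And>z. z \<notin> N \<Longrightarrow>
      eval4 T (weierstrass_p \<Omega> z) z (weierstrass_zeta \<Omega> z) (riemann_zeta z) = 0"
  shows "T = 0"
proof (rule ccontr)
  assume "T \<noteq> 0"
  then obtain T' n where T: "T = [:-1, 1:] ^ n * T'" and "\<not> [:-1, 1:] dvd T'"
    using order_decomp[of T 1] by blast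
  then have nz: "poly T' 1 \<noteq> 0" using poly_eq_0_iff_dvd[of T' 1] by simp
  define S where "S = poly T' 1"
  obtain V where V: "\<And>p x y w. eval4 T' p x y w = (w - 1) * eval4 V p x y w + eval3 S p x y"
    using eval4_divide_linear[of T'] unfolding S_def by metis
  obtain \<eta>1 where \<eta>1: "\<And>z. z \<notin> \<Omega> \<Longrightarrow> weierstrass_zeta \<Omega> (z + \<omega>1) = weierstrass_zeta \<Omega> z + \<eta>1"
    using weierstrass_zeta_quasi_periodic[OF basis_mem(1)] by blast
  obtain \<eta>2 where \<eta>2: "\<And>z. z \<notin> \<Omega> \<Longrightarrow> weierstrass_zeta \<Omega> (z + \<omega>2) = weierstrass_zeta \<Omega> z + \<eta>2"
    using weierstrass_zeta_quasi_periodic[OF basis_mem(2)] by blast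
  define \<Delta> where "\<Delta> = \<omega>1 * \<eta>2 - \<omega>2 * \<eta>1"
  have \<Delta>: "\<Delta> \<noteq> 0" unfolding \<Delta>_def by (rule quasi_periods_independent[OF \<eta>1 \<eta>2])
  \<comment> \<open>The points with some lattice translate in N. Off this countable set the relation
    holds at all sample points at once.\<close>
  define N' where "N' = (\<Union>a\<in>\<Omega>. (\<lambda>z. z - a) ` N)"
  have "countable N'" unfolding N'_def using countable_lattice assms(2) by auto
  have "eval3 S (weierstrass_p \<Omega> z0) x y = 0" if z0: "z0 \<in> - \<Omega> - N'" for z0 x y
  proof -
    define p0 where "p0 = weierstrass_p \<Omega> z0"
    \<comment> \<open>Parameters u and v are complex, so that identities found at natural arguments
      can be extended.\<close>
    define X where "X = (\<lambda>u v. z0 + u * \<omega>1 + v * \<omega>2)"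
    define Y where "Y = (\<lambda>u v. weierstrass_zeta \<Omega> z0 + u * \<eta>1 + v * \<eta>2)"
    \<comment> \<open>Here n is a lattice coefficient; it shadows the exponent n of the
      factorisation of T.\<close>
    have lim: "(\<lambda>k. eval3 S p0 (X (of_nat k) (of_nat n)) (Y (of_nat k) (of_nat n))) \<longlonglongrightarrow> 0" for n
    proof -
      define x where "x = (\<lambda>k. X (of_nat k) (of_nat n))"
      define y where "y = (\<lambda>k. Y (of_nat k) (of_nat n))"
      define w where "w = (\<lambda>k. riemann_zeta (x k))"
      have rel_x: "eval4 T p0 (x k) (y k) (w k) = 0" for k
      proof -
        have a: "of_nat k * \<omega>1 + of_nat n * \<omega>2 \<in> \<Omega>" by (intro add_mem of_nat_mult_mem basis_mem)
        have xk: "x k = z0 + (of_nat k * \<omega>1 + of_nat n * \<omega>2)" by (simp add: x_def X_def add_ac)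
        have "x k \<notin> N"
        proof
          assume "x k \<in> N"
          then have "z0 \<in> (\<lambda>z. z - (of_nat k * \<omega>1 + of_nat n * \<omega>2)) ` N"
            by (rule rev_image_eqI) (simp add: xk)
          then show False using z0 a unfolding N'_def by blast
        qed
        moreover have "weierstrass_p \<Omega> (x k) = p0"
          unfolding xk p0_def using z0 by (intro weierstrass_p_periodic a) auto
        moreover have "weierstrass_zeta \<Omega> (x k) = y k"
        proof -
          have "z0 + of_nat k * \<omega>1 \<notin> \<Omega>" using z0 by (simp add: add_mem_iff of_nat_mult_mem basis_mem)
          from weierstrass_zeta_add_of_nat_mult[OF basis_mem(2) \<eta>2 this]
            weierstrass_zeta_add_of_nat_mult[OF basis_mem(1) \<eta>1, of z0 k]
          show ?thesis using z0 by (simp add: x_def X_def y_def Y_def)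
        qed
        ultimately show ?thesis using rel[of "x k"] by (simp add: w_def)
      qed
      have Re_x: "Re (x k) = Re z0 + real n * Re \<omega>2 + real k * Re \<omega>1" for k
        by (simp add: x_def X_def)
      have "filterlim (\<lambda>k. Re (x k)) at_top sequentially"
        unfolding Re_x using assms(1) by real_asymp
      then have asymp: "(\<lambda>k. 2 powr x k * (w k - 1)) \<longlonglongrightarrow> 1"
        unfolding w_def by (rule riemann_zeta_asymp) simp
      \<comment> \<open>r is the decay of 2^(-s) per step by \<omega>1, and C collects the fixed
        offset. The factor 2 leaves room above the limit 1 of 2^s (zeta_R(s) - 1).\<close>
      define r where "r = 2 powr (- Re \<omega>1)"
      define C where "C = 2 * 2 powr (- (Re z0 + real n * Re \<omega>2))"
      have r: "0 < r" "r < 1" using assms(1) by (auto simp: r_def powr_less_one)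
      have "\<forall>\<^sub>F k in sequentially. norm (2 powr x k * (w k - 1)) < 2"
        using order_tendstoD(2)[OF tendsto_norm[OF asymp], of 2] by simp
      then have w_le: "\<forall>\<^sub>F k in sequentially. norm (w k - 1) \<le> C * r ^ k"
      proof eventually_elim
        case (elim k)
        have "norm (2 powr x k) = 2 powr Re (x k)" using norm_powr_real_powr[of 2 "x k"] by simp
        with elim[unfolded norm_mult] have "norm (w k - 1) \<le> 2 * 2 powr (- Re (x k))"
          by (simp add: powr_minus field_simps)
        also have "\<dots> = C * r powr (real k)"
          unfolding C_def r_def powr_powr by (simp add: Re_x mult_ac flip: powr_add)
        also have "r powr (real k) = r ^ k" using r by (simp add: powr_realpow)
        finally show ?case .
      qed
      have "(\<lambda>k. w k - 1) \<longlonglongrightarrow> 0"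
        using poly_bounded_times_exp_decay[OF poly_bounded.const[of 1] w_le r] by simp
      \<comment> \<open>The cofactor V still contains W, so W itself must be bounded for V to grow
        at most polynomially.\<close>
      then have "convergent w" unfolding convergent_def LIM_zero_iff by blast
      then have "poly_bounded w"
        using convergent_imp_Bseq[of w] unfolding Bseq_def by (auto intro: poly_bounded_bounded)
      moreover have "poly_bounded x" "poly_bounded y"
        unfolding x_def X_def y_def Y_def
        by (intro poly_bounded.add poly_bounded.mult poly_bounded.const poly_bounded_of_nat)+
      ultimately have "poly_bounded (\<lambda>k. eval4 V p0 (x k) (y k) (w k))"
        by (intro poly_bounded.eval4 poly_bounded.const)
      from poly_bounded_times_exp_decay[OF this w_le r]
      have "(\<lambda>k. - ((w k - 1) * eval4 V p0 (x k) (y k) (w k))) \<longlonglongrightarrow> 0"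
        using tendsto_minus by fastforce
      \<comment> \<open>The nonzero limit also shows that W is eventually different from 1, so the
        power of W - 1 can be cancelled from the relation.\<close>
      moreover have "\<forall>\<^sub>F k in sequentially. 2 powr x k * (w k - 1) \<noteq> 0"
        using tendsto_imp_eventually_ne[OF asymp, of 0] by simp
      then have "\<forall>\<^sub>F k in sequentially. - ((w k - 1) * eval4 V p0 (x k) (y k) (w k)) = eval3 S p0 (x k) (y k)"
      proof eventually_elim
        case (elim k)
        then have "eval4 T' p0 (x k) (y k) (w k) = 0"
          using rel_x[of k] by (simp add: T eval4_mult eval4_power eval4_linear)
        then show ?case unfolding V by (simp add: neg_eq_iff_add_eq_0)
      qed
      ultimately show ?thesis
        unfolding x_def y_def by (rule Lim_transform_eventually)
    qed
    have zero: "f t = 0" if f: "polynomial_fun f" "(\<lambda>k. f (of_nat k)) \<longlonglongrightarrow> 0" for f t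
    proof -
      obtain q where q: "\<And>t. f t = poly q t" using f(1) unfolding polynomial_fun_def by blast
      with f(2) have "q = 0" by (intro poly_eq_0_if_tendsto_0) simp
      then show ?thesis by (simp add: q)
    qed
    note polynomial_intros = polynomial_fun.eval3 polynomial_fun.add polynomial_fun.mult
      polynomial_fun.const polynomial_fun_id
    \<comment> \<open>For fixed natural n the limit in k forces a polynomial in u to vanish. Then,
      for fixed complex u, the polynomial in v vanishes at all naturals and hence
      identically.\<close>
    have G1: "eval3 S p0 (X u (of_nat n)) (Y u (of_nat n)) = 0" for u n
    proof -
      have "polynomial_fun (\<lambda>u. eval3 S p0 (X u (of_nat n)) (Y u (of_nat n)))"
        unfolding X_def Y_def by (intro polynomial_intros)
      then show ?thesis using lim[of n] by (rule zero)
    qed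
    have G: "eval3 S p0 (X u v) (Y u v) = 0" for u v
    proof -
      have "polynomial_fun (\<lambda>v. eval3 S p0 (X u v) (Y u v))"
        unfolding X_def Y_def by (intro polynomial_intros)
      then show ?thesis by (rule zero) (simp add: G1)
    qed
    \<comment> \<open>Cramer's rule with determinant \<Delta>: every pair (x, y) is reached as (X u
      v, Y u v).\<close>
    define u where "u = ((x - z0) * \<eta>2 - (y - weierstrass_zeta \<Omega> z0) * \<omega>2) / \<Delta>"
    define v where "v = (\<omega>1 * (y - weierstrass_zeta \<Omega> z0) - \<eta>1 * (x - z0)) / \<Delta>"
    have uv: "u * \<Delta> = (x - z0) * \<eta>2 - (y - weierstrass_zeta \<Omega> z0) * \<omega>2"
      "v * \<Delta> = \<omega>1 * (y - weierstrass_zeta \<Omega> z0) - \<eta>1 * (x - z0)"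
      using \<Delta> by (simp_all add: u_def v_def)
    have "X u v * \<Delta> = z0 * \<Delta> + (u * \<Delta>) * \<omega>1 + (v * \<Delta>) * \<omega>2"
      "Y u v * \<Delta> = weierstrass_zeta \<Omega> z0 * \<Delta> + (u * \<Delta>) * \<eta>1 + (v * \<Delta>) * \<eta>2"
      by (simp_all add: X_def Y_def algebra_simps)
    then have "X u v * \<Delta> = x * \<Delta>" "Y u v * \<Delta> = y * \<Delta>"
      unfolding uv by (simp_all add: \<Delta>_def algebra_simps)
    then have "X u v = x" "Y u v = y" using \<Delta> by simp_all
    with G[of u v] show ?thesis by (simp add: p0_def)
  qed
  then have "S = 0"
    by (intro eval3_eq_0I[OF infinite_weierstrass_p_values[OF \<open>countable N'\<close>]]) auto
  with nz show False by (simp add: S_def)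
qed

section \<open>Choice of a suitable basis\<close>

lemma lattice_basis_swap: "lattice_basis \<Omega> \<omega>2 \<omega>1"
proof
  show "\<Omega> = {of_int m * \<omega>2 + of_int n * \<omega>1 | m n. True}"
    unfolding lattice_eq by (metis add.commute)
  show "Im (\<omega>2 * cnj \<omega>1) \<noteq> 0" using Im_nonzero by (simp add: mult.commute)
qed

lemma lattice_basis_minus: "lattice_basis \<Omega> (- \<omega>1) \<omega>2"
proof
  have eq: "of_int m * - \<omega>1 + of_int n * \<omega>2 = of_int (- m) * \<omega>1 + of_int n * \<omega>2" for m n by simp
  show "\<Omega> = {of_int m * - \<omega>1 + of_int n * \<omega>2 | m n. True}"
    unfolding lattice_eq eq by (metis minus_minus)
  show "Im (- \<omega>1 * cnj \<omega>2) \<noteq> 0" using Im_nonzero by simp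
qed

text \<open>The real parts of a basis cannot both vanish, as the determinant would then be 0. A swap
  and a sign change do the rest.\<close>

lemma Re_positive_basis:
  obtains a b where "lattice_basis \<Omega> a b" "Re a > 0"
proof -
  have "Re \<omega>1 \<noteq> 0 \<or> Re \<omega>2 \<noteq> 0" using Im_nonzero by auto
  moreover have ?thesis if "lattice_basis \<Omega> a b" "Re a \<noteq> 0" for a b
    using that(2) that(1) lattice_basis.lattice_basis_minus[OF that(1)]
    by (cases "Re a > 0") (auto intro: \<open>\<And>b a. lattice_basis \<Omega> a b \<Longrightarrow> 0 < Re a \<Longrightarrow> thesis\<close>)
  ultimately show ?thesis using lattice_basis_axioms lattice_basis_swap by blast
qed

end

lemma is_lattice_imp_basis:
  assumes "is_lattice \<Omega>"
  obtains a b where "lattice_basis \<Omega> a b" "Re a > 0"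
proof -
  obtain a b where ab: "a \<noteq> b" "independent {a, b}" "\<Omega> = {of_int m * a + of_int n * b | m n. True}"
    using assms unfolding is_lattice_def by blast
  then have a: "a \<notin> span {b}" by (simp add: independent_insert)
  then have "b \<noteq> 0" using ab(2) dependent_zero by auto
  have "Im (a * cnj b) \<noteq> 0"
  proof
    assume "Im (a * cnj b) = 0"
    \<comment> \<open>If a * cnj b is real, multiplying by b exhibits a as a real multiple of b,
      which contradicts independence.\<close>
    then have "a * cnj b = of_real (Re (a * cnj b))" by (simp add: complex_eq_iff)
    then have "a * (b * cnj b) = of_real (Re (a * cnj b)) * b" by (metis mult.commute mult.left_commute)
    then have "a * of_real ((norm b)\<^sup>2) = of_real (Re (a * cnj b)) * b"
      by (simp only: complex_norm_square)
    then have "a = (Re (a * cnj b) / (norm b)\<^sup>2) *\<^sub>R b"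
      using \<open>b \<noteq> 0\<close> by (simp add: scaleR_conv_of_real field_simps)
    then show False using a by (metis span_base span_scale singletonI)
  qed
  then interpret lattice_basis \<Omega> a b by unfold_locales (use ab in auto)
  show ?thesis using Re_positive_basis that by blast
qed

theorem proposition7p1:
  fixes \<Omega> :: "complex set"
  assumes "is_lattice \<Omega>"
  shows "algebraically_independent
           [\<lambda>z. z, weierstrass_p \<Omega>, weierstrass_zeta \<Omega>, riemann_zeta]"
  unfolding algebraically_independent_def
proof (intro allI impI)
  fix P :: "(nat \<Rightarrow>\<^sub>0 nat) \<Rightarrow>\<^sub>0 complex"
  let ?fs = "[\<lambda>z. z, weierstrass_p \<Omega>, weierstrass_zeta \<Omega>, riemann_zeta]"
  assume "\<forall>m\<in>Poly_Mapping.keys P. Poly_Mapping.keys m \<subseteq> {..<length ?fs}"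
  then have keys: "\<forall>m\<in>Poly_Mapping.keys P. Poly_Mapping.keys m \<subseteq> {..<4}"
    by (simp add: eval_nat_numeral)
  assume "\<forall>\<^sub>F z in cosparse UNIV. mpoly_eval P (\<lambda>i. (?fs ! i) z) = 0"
  then have "{z. mpoly_eval P (\<lambda>i. (?fs ! i) z) \<noteq> 0} sparse_in UNIV"
    by (simp add: eventually_cosparse)
  then have "countable {z. mpoly_eval P (\<lambda>i. (?fs ! i) z) \<noteq> 0}"
    using sparse_imp_countable[OF open_UNIV] by simp
  obtain a b where ab: "lattice_basis \<Omega> a b" "Re a > 0"
    using assms by (rule is_lattice_imp_basis)
  have "nested_poly P = 0"
  proof (rule lattice_basis.no_algebraic_relation[OF ab])
    show "countable {z. mpoly_eval P (\<lambda>i. (?fs ! i) z) \<noteq> 0}" by fact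
    fix z assume z: "z \<notin> {z. mpoly_eval P (\<lambda>i. (?fs ! i) z) \<noteq> 0}"
    \<comment> \<open>Indexing a list of values agrees with evaluating an indexed function only
      below the length 4; \<open>keys\<close> confines the variables to that range.\<close>
    have "mpoly_eval P (\<lambda>i. [z, weierstrass_p \<Omega> z, weierstrass_zeta \<Omega> z, riemann_zeta z] ! i) =
        mpoly_eval P (\<lambda>i. (?fs ! i) z)"
      unfolding mpoly_eval_def
    proof (intro sum.cong arg_cong2[where f = "(*)"] prod.cong refl arg_cong2[where f = "(^)"])
      fix m i assume "m \<in> Poly_Mapping.keys P" "i \<in> Poly_Mapping.keys m"
      then have "i < 4" using keys by blast
      then show "[z, weierstrass_p \<Omega> z, weierstrass_zeta \<Omega> z, riemann_zeta z] ! i = (?fs ! i) z"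
        by (auto simp: eval_nat_numeral less_Suc_eq)
    qed
    with z show "eval4 (nested_poly P) (weierstrass_p \<Omega> z) z (weierstrass_zeta \<Omega> z) (riemann_zeta z) = 0"
      by (simp add: eval4_nested_poly[OF keys])
  qed
  then show "P = 0" by (rule nested_poly_eq_0D[OF keys])
qed

end
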